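(* Suppose $(\mathbf u^{n+1},\phi^{n+1})$ is obtained from $(\mathbf u^n,\phi^n)$ and $(\mathbf u^{n-1},\phi^{n-1})$ by the three-step operator-splitting time-discretization scheme for the Cahn-Hilliard-Navier-Stokes system described in the context, with intermediate quantities $\mathbf u_\star,\mathbf u_{\star\star},\mu^{n+1/2}$ as there. Then the scheme is energy stable in the sense that $$\mathcal E(\mathbf u^{n+1},\phi^{n+1})-\mathcal E(\mathbf u^n,\phi^n)\le-\frac{\delta t}{2}\Big[\eta\Big\|\nabla\frac{\mathbf u_\star+\mathbf u^n}{2}\Big\|^2+\eta\Big\|\nabla\frac{\mathbf u^{n+1}+\mathbf u_{\star\star}}{2}\Big\|^2+2\Big\|\sqrt{M(\overline\phi^{\,n+\frac12})}\,\nabla\mu^{n+\frac12}\Big\|^2\Big],$$ where $$\mathcal E(\mathbf u,\phi)=E(\mathbf u)+F(\phi),\qquad E(\mathbf u)=\int_\Omega\frac{\rho}{2}|\mathbf u|^2d\mathbf x,\qquad F(\phi)=\gamma\int_\Omega\Big(\frac{\varepsilon}{2}|\nabla\phi|^2+\frac1\varepsilon f(\phi)\Big)d\mathbf x .$$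
   Context: $\Omega$ is a bounded domain with boundary $\partial\Omega$ and outward unit normal $\mathbf n$; $\rho,\eta,\gamma,\varepsilon>0$ are constants; $M(\cdot)\ge0$ is the mobility function; $f(\phi)=\frac14(\phi^2-1)^2$; $\delta t>0$ is the time step. $\|\cdot\|$ is the $L^2(\Omega)$ norm. All functions of space are assumed regular enough for the equations and integrations by parts to make classical sense (time is discretized, space is continuous). Notation: $B(\mathbf v,\mathbf u)=\frac12[\mathbf v\cdot\nabla\mathbf u+\nabla\cdot(\mathbf v\mathbf u)]$, where the $i$-th component of $\nabla\cdot(\mathbf v\mathbf u)$ is $\nabla\cdot(\mathbf v u_i)$. Extrapolations: $\overline g^{\,n+1/4}=\frac54g^n-\frac14g^{n-1}$, $\overline g^{\,n+1/2}=\frac32g^n-\frac12g^{n-1}$, $\overline g^{\,n+3/4}=\frac74g^n-\frac34g^{n-1}$. Discrete derivative of $f$: $\frac{\delta f}{\delta(a,b)}=\big[\frac{a^2+b^2}{2}-1\big]\frac{a+b}{2}$. Data: $(\mathbf u^k,\phi^k)$, $k=n-1,n$, satisfying $\nabla\cdot\mathbf u^k=0$ in $\Omega$, and $\mathbf u^k=0$ (in particular $\mathbf u^n\cdot\mathbf n=0$), $\nabla\phi^k\cdot\mathbf n=0$ on $\partial\Omega$. The scheme (each step has its own pressure): Step 1: set $\phi_\star=\phi^n$; $\mathbf u_\star$, $p_1$ satisfy $\rho\frac{\mathbf u_\star-\mathbf u^n}{\delta t/2}+B(\overline{\mathbf u}^{\,n+1/4},\frac{\mathbf u_\star+\mathbf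 u^n}{2})=-\nabla p_1+\eta\Delta\frac{\mathbf u_\star+\mathbf u^n}{2}$, $\nabla\cdot\frac{\mathbf u_\star+\mathbf u^n}{2}=0$ in $\Omega$, $\mathbf u_\star=0$ on $\partial\Omega$. Step 2.1: $\phi_{\star\star}$, $\mu^{n+1/2}$, $p_2$ satisfy $\frac{\phi_{\star\star}-\phi_\star}{\delta t}+\nabla\cdot(\mathbf u_\star\overline\phi^{\,n+1/2})=\nabla\cdot\big((M(\overline\phi^{\,n+1/2})+\frac{\delta t}{2\rho}(\overline\phi^{\,n+1/2})^2)\nabla\mu^{n+1/2}\big)+\frac{\delta t}{2\rho}\nabla\cdot(\overline\phi^{\,n+1/2}\nabla p_2)$, $\mu^{n+1/2}=-\frac{\gamma\varepsilon}{2}(\Delta\phi_{\star\star}+\Delta\phi_\star)+\frac\gamma\varepsilon\frac{\delta f}{\delta(\phi_{\star\star},\phi_\star)}$, $-\Delta p_2-\nabla\cdot(\overline\phi^{\,n+1/2}\nabla\mu^{n+1/2})=0$ in $\Omega$, and $\nabla\mu^{n+1/2}\cdot\mathbf n=0$, $\nabla\phi_{\star\star}\cdot\mathbf n=0$, $\nabla p_2\cdot\mathbf n=0$ on $\partial\Omega$. Step 2.2: $\mathbf u_{\star\star}=\mathbf u_\star-\frac{\delta t}{\rho}(\nabla p_2+\overline\phi^{\,n+1/2}\nabla\mu^{n+1/2})$. Step 2 is the decoupled form of the system $\rho\frac{\mathbf u_{\star\star}-\mathbf u_\star}{\delta t}=-\nabla p_2-\overline\phi^{\,n+1/2}\nabla\mu^{n+1/2}$,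 $\nabla\cdot\mathbf u_{\star\star}=0$, $\frac{\phi_{\star\star}-\phi_\star}{\delta t}=-\nabla\cdot(\frac{\mathbf u_{\star\star}+\mathbf u_\star}{2}\overline\phi^{\,n+1/2})+\nabla\cdot(M(\overline\phi^{\,n+1/2})\nabla\mu^{n+1/2})$ (same $\mu^{n+1/2}$), whose boundary conditions include $\mathbf u_{\star\star}=0$ on $\partial\Omega$; this boundary condition is assumed to hold. Step 3: set $\phi^{n+1}=\phi_{\star\star}$; $\mathbf u^{n+1}$, $p_3$ satisfy $\rho\frac{\mathbf u^{n+1}-\mathbf u_{\star\star}}{\delta t/2}+B(\overline{\mathbf u}^{\,n+3/4},\frac{\mathbf u^{n+1}+\mathbf u_{\star\star}}{2})=-\nabla p_3+\eta\Delta\frac{\mathbf u_{\star\star}+\mathbf u^{n+1}}{2}$, $\nabla\cdot\mathbf u^{n+1}=0$ in $\Omega$, $\mathbf u^{n+1}=0$ on $\partial\Omega$. *)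

theory Defs
  imports "HOL-Analysis.Analysis"
begin

definition partial :: "'a::euclidean_space \<Rightarrow> ('a \<Rightarrow> 'b::real_normed_vector) \<Rightarrow> 'a \<Rightarrow> 'b" where
  "partial i f x = frechet_derivative f (at x) i"

definition grad :: "('a::euclidean_space \<Rightarrow> real) \<Rightarrow> 'a \<Rightarrow> 'a" where
  "grad f x = (\<Sum>i\<in>Basis. partial i f x *\<^sub>R i)"

definition divg :: "('a::euclidean_space \<Rightarrow> 'a) \<Rightarrow> 'a \<Rightarrow> real" where
  "divg v x = (\<Sum>i\<in>Basis. partial i v x \<bullet> i)"

definition lapl :: "('a::euclidean_space \<Rightarrow> 'b::real_normed_vector) \<Rightarrow> 'a \<Rightarrow> 'b" where
  "lapl f x = (\<Sum>i\<in>Basis. partial i (partial i f) x)"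

text \<open>Pointwise Frobenius norm of the gradient tensor of a vector field.\<close>

definition grad_abs :: "('a::euclidean_space \<Rightarrow> 'a) \<Rightarrow> 'a \<Rightarrow> real" where
  "grad_abs u x = sqrt (\<Sum>i\<in>Basis. (norm (partial i u x))\<^sup>2)"

text \<open>The convection form: half of v.grad u plus the field with components div (v u_i).\<close>

definition convB :: "('a::euclidean_space \<Rightarrow> 'a) \<Rightarrow> ('a \<Rightarrow> 'a) \<Rightarrow> 'a \<Rightarrow> 'a" where
  "convB v u x = (1/2) *\<^sub>R ((\<Sum>i\<in>Basis. (v x \<bullet> i) *\<^sub>R partial i u x)
      + (\<Sum>i\<in>Basis. divg (\<lambda>y. (u y \<bullet> i) *\<^sub>R v y) x *\<^sub>R i))"

text \<open>The extrapolation of g (time level n) and g' (time level n - 1) to the time level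
  n + s; for s = 1/4, 1/2, 3/4 the weights are 5/4, -1/4; 3/2, -1/2; 7/4, -3/4.\<close>

definition extrap :: "real \<Rightarrow> ('a \<Rightarrow> 'b::real_vector) \<Rightarrow> ('a \<Rightarrow> 'b) \<Rightarrow> 'a \<Rightarrow> 'b" where
  "extrap s g g' x = (1 + s) *\<^sub>R g x - s *\<^sub>R g' x"

definition avg :: "('a \<Rightarrow> 'b::real_vector) \<Rightarrow> ('a \<Rightarrow> 'b) \<Rightarrow> 'a \<Rightarrow> 'b" where
  "avg g h x = (1/2) *\<^sub>R (g x + h x)"

definition dwell :: "real \<Rightarrow> real" where
  "dwell s = (1/4) * (s\<^sup>2 - 1)\<^sup>2"

definition dwell_discr_deriv :: "real \<Rightarrow> real \<Rightarrow> real" where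
  "dwell_discr_deriv a b = ((a\<^sup>2 + b\<^sup>2) / 2 - 1) * ((a + b) / 2)"

text \<open>Functions are total, but only their values on the open set \<open>\<Omega>\<close> matter; boundary values are
  limits from within \<open>\<Omega>\<close>. For bounded \<open>\<Omega>\<close>, \<open>Ck_closure k \<Omega>\<close> is the usual space of
  functions of class C^k on \<open>\<Omega>\<close> all of whose partial derivatives of order at most k
  extend continuously to the closure (equivalently, are uniformly continuous).\<close>

fun Ck_closure :: "nat \<Rightarrow> 'a::euclidean_space set \<Rightarrow> ('a \<Rightarrow> 'b::real_normed_vector) \<Rightarrow> bool" where
  "Ck_closure 0 \<Omega> f = uniformly_continuous_on \<Omega> f"
| "Ck_closure (Suc k) \<Omega> f = (uniformly_continuous_on \<Omega> f \<and> f differentiable_on \<Omega> \<and>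
      (\<forall>i\<in>Basis. Ck_closure k \<Omega> (partial i f)))"

text \<open>\<open>\<nu>\<close> is the outward unit normal of \<open>\<Omega>\<close> at the boundary point \<open>x\<close>: near \<open>x\<close>, \<open>\<Omega>\<close> is the
  sublevel set of a C^1 function without critical points that vanishes at \<open>x\<close>.\<close>

definition outward_unit_normal :: "'a::euclidean_space set \<Rightarrow> 'a \<Rightarrow> 'a \<Rightarrow> bool" where
  "outward_unit_normal \<Omega> x \<nu> \<longleftrightarrow> (\<exists>U r. open U \<and> x \<in> U \<and>
      r differentiable_on U \<and> continuous_on U (grad r) \<and> (\<forall>y\<in>U. grad r y \<noteq> 0) \<and>
      \<Omega> \<inter> U = {y \<in> U. r y < 0} \<and> r x = 0 \<and> \<nu> = grad r x /\<^sub>R norm (grad r x))"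

text \<open>Vanishing Hausdorff measure of dimension DIM('a) - 1, for compact sets (whence the
  finite covers). In dimension 1 this forces \<open>S = {}\<close>.\<close>

definition compact_hypersurface_null :: "'a::euclidean_space set \<Rightarrow> bool" where
  "compact_hypersurface_null S \<longleftrightarrow> (\<forall>e>0. \<exists>C :: ('a \<times> real) set. finite C \<and> (\<forall>(c, r)\<in>C. 0 < r) \<and>
      S \<subseteq> (\<Union>(c, r)\<in>C. ball c r) \<and> (\<Sum>(c, r)\<in>C. r ^ (DIM('a) - 1)) < e)"

text \<open>A bounded domain whose boundary is C^1, with \<open>\<Omega>\<close> on one side, outside a (closed) null
  set of boundary points. This covers C^1 domains (empty exceptional set) as well as
  domains with edges and corners such as boxes.\<close>

definition bounded_domain :: "'a::euclidean_space set \<Rightarrow> bool" where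
  "bounded_domain \<Omega> \<longleftrightarrow> open \<Omega> \<and> connected \<Omega> \<and> \<Omega> \<noteq> {} \<and> bounded \<Omega> \<and>
      compact_hypersurface_null {x \<in> frontier \<Omega>. \<nexists>\<nu>. outward_unit_normal \<Omega> x \<nu>}"

definition zero_on_boundary :: "'a::euclidean_space set \<Rightarrow> ('a \<Rightarrow> 'b::real_normed_vector) \<Rightarrow> bool" where
  "zero_on_boundary \<Omega> u \<longleftrightarrow> (\<forall>x\<in>frontier \<Omega>. (u \<longlongrightarrow> 0) (at x within \<Omega>))"

definition zero_normal_derivative :: "'a::euclidean_space set \<Rightarrow> ('a \<Rightarrow> real) \<Rightarrow> bool" where
  "zero_normal_derivative \<Omega> \<phi> \<longleftrightarrow> (\<forall>x\<in>frontier \<Omega>. \<forall>\<nu>. outward_unit_normal \<Omega> x \<nu> \<longrightarrow>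
      ((\<lambda>y. grad \<phi> y \<bullet> \<nu>) \<longlongrightarrow> 0) (at x within \<Omega>))"

definition L2_norm :: "'a::euclidean_space set \<Rightarrow> ('a \<Rightarrow> 'b::real_normed_vector) \<Rightarrow> real" where
  "L2_norm \<Omega> g = sqrt (LINT x:\<Omega>|lborel. (norm (g x))\<^sup>2)"

definition kinetic_energy :: "real \<Rightarrow> 'a::euclidean_space set \<Rightarrow> ('a \<Rightarrow> 'a) \<Rightarrow> real" where
  "kinetic_energy \<rho> \<Omega> u = (LINT x:\<Omega>|lborel. \<rho> / 2 * (norm (u x))\<^sup>2)"

definition free_energy :: "real \<Rightarrow> real \<Rightarrow> 'a::euclidean_space set \<Rightarrow> ('a \<Rightarrow> real) \<Rightarrow> real" where
  "free_energy \<gamma> \<epsilon> \<Omega> \<phi> =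
     \<gamma> * (LINT x:\<Omega>|lborel. \<epsilon> / 2 * (norm (grad \<phi> x))\<^sup>2 + 1 / \<epsilon> * dwell (\<phi> x))"

definition total_energy ::
  "real \<Rightarrow> real \<Rightarrow> real \<Rightarrow> 'a::euclidean_space set \<Rightarrow> ('a \<Rightarrow> 'a) \<Rightarrow> ('a \<Rightarrow> real) \<Rightarrow> real" where
  "total_energy \<rho> \<gamma> \<epsilon> \<Omega> u \<phi> = kinetic_energy \<rho> \<Omega> u + free_energy \<gamma> \<epsilon> \<Omega> \<phi>"

end

(* The boundary integrals in the energy identity vanish by a divergence theorem for fields without
   normal component at the regular boundary points. Given such a field v, build functions q with
   q = 1 near the boundary and with the integral of q + |v . grad q| arbitrarily small; then
   (1 - q) v has compact support, so its divergence integrates to 0 by translation invariance of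
   Lebesgue measure, and q tends to 0. Near the singular boundary points q is built from bumps on
   small balls; a ball of radius s in dimension d costs const * s^(d-1). Near a regular point, where
   the domain is {r < 0}, q is a cutoff of the strip {r > -const/n}; its gradient is of order n, but
   it is parallel to grad r up to bounded terms, and v . grad r is uniformly small on the strip.

   Testing step 1 and step 3 with the averaged velocity, and step 2 with the averaged velocity, mu
   and the discrete time derivative of phi, the change of the energy density in each step equals minus
   the dissipation plus the divergence of one single field of this kind. In particular the coupling
   terms of step 2 cancel and the estimate is an equality. *)

theory Submission
  imports Defs
begin

section \<open>Compactly supported functions\<close>

text \<open>Because the normal component vanishes, no surface integral has to be defined: the
  boundary term of Gauss's theorem is replaced by \<open>q * divg v + v . grad q\<close>, the
  difference between the divergences of \<open>v\<close> and \<open>(1 - q) v\<close>. This is why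
  the cost charges \<open>q\<close> beside \<open>v . grad q\<close>: \<open>divg v\<close> is
  bounded, so \<open>q\<close> pays for the first summand. At singular points boundedness of
  \<open>v\<close> suffices, since the balls covering them have small total surface. Regular points
  carry positive surface, so there the smallness of \<open>v . grad r\<close> has to beat a gradient
  of order n, which requires a strip of volume O(1/n). That volume is controlled without charts or
  surface measure, by a second use of the translation identity: \<open>grad q . e\<close> integrates
  to 0 for a fixed direction \<open>e\<close> in which \<open>r\<close> grows at a definite rate.
  The large part of \<open>grad q . e\<close> has one sign, so its mass is at most that of the
  bounded part. The pieces are glued by multiplying the complements \<open>1 - q\<close>, under
  which costs add, and compactness reduces the frontier to finitely many pieces.\<close>

lemma set_integrable_bounded_continuous:
  fixes f :: "'a::euclidean_space \<Rightarrow> 'b::euclidean_space"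
  assumes "open S" "bounded S" "continuous_on S f" "bounded (f ` S)"
  shows "set_integrable lborel S f"
proof -
  obtain B where B: "\<And>x. x \<in> S \<Longrightarrow> norm (f x) \<le> B"
    using assms(4) by (auto simp: bounded_iff)
  have "(\<lambda>x. indicator S x *\<^sub>R f x) \<in> borel_measurable lborel"
    using assms by (simp add: borel_measurable_continuous_on_indicator)
  moreover have "emeasure lborel S < \<infinity>"
    using assms(2) by (rule emeasure_bounded_finite)
  ultimately show ?thesis
    unfolding set_integrable_def
    using assms(1) B by (intro integrableI_bounded_set[where A=S and B=B]) (auto simp: indicator_def)
qed

lemma gradient_eq_0:
  fixes f :: "'a::euclidean_space \<Rightarrow> real"
  assumes "(f has_derivative (\<lambda>h. d \<bullet> h)) (at x)"
    and "open S" "x \<in> S" "\<And>y. y \<in> S \<Longrightarrow> f y = 0"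
  shows "d = 0"
proof -
  have "((\<lambda>_. 0) has_derivative (\<lambda>h. d \<bullet> h)) (at x)"
    using has_derivative_transform_within_open[OF assms(1-3), of "\<lambda>_. 0"] assms(4) by simp
  then have "(\<lambda>h. d \<bullet> h) = (\<lambda>_. 0)"
    using has_derivative_unique[OF _ has_derivative_const] by blast
  then have "d \<bullet> d = 0" by metis
  then show ?thesis by simp
qed

text \<open>Difference quotients of \<open>g\<close> in direction \<open>e\<close> integrate to 0 by
  translation invariance. The gradient is continuous and vanishes off a ball, hence is bounded; so
  \<open>g\<close> is Lipschitz, the quotients have a common integrable majorant, and dominated
  convergence passes to the derivative.\<close>

lemma integral_directional_derivative_eq_0:
  fixes g :: "'a::euclidean_space \<Rightarrow> real"
  assumes g: "\<And>x. (g has_derivative (\<lambda>h. dg x \<bullet> h)) (at x)"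
    and dg: "continuous_on UNIV dg"
    and bd: "bounded {x. g x \<noteq> 0}"
  shows "(LINT x|lborel. dg x \<bullet> e) = 0"
proof -
  obtain R where R: "R > 0" "{x. g x \<noteq> 0} \<subseteq> ball 0 R"
    using bounded_subset_ballD[OF bd] by blast
  have dg0: "dg x = 0" if "x \<notin> cball 0 R" for x
  proof -
    show ?thesis
      by (rule gradient_eq_0[OF g, where S="- cball 0 R"]) (use that R(2) in auto)
  qed
  have "bounded (dg ` cball 0 R)"
    by (meson compact_cball compact_continuous_image compact_imp_bounded continuous_on_subset dg subset_UNIV)
  then obtain B where B: "B > 0" "\<And>x. x \<in> cball 0 R \<Longrightarrow> norm (dg x) \<le> B"
    by (auto simp: bounded_pos)
  have dgB: "norm (dg x) \<le> B" for x
    using B dg0[of x] by (cases "x \<in> cball 0 R") auto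
  have lip: "\<bar>g x - g y\<bar> \<le> B * norm (x - y)" for x y
  proof -
    have "norm (g x - g y) \<le> B * norm (x - y)"
    proof (rule differentiable_bound[where S=UNIV])
      show "(g has_derivative (\<lambda>h. dg z \<bullet> h)) (at z within UNIV)" for z using g by simp
      show "onorm (\<lambda>h. dg z \<bullet> h) \<le> B" for z
        using order_trans[OF Cauchy_Schwarz_ineq2[of "dg z"] mult_right_mono[OF dgB[of z] norm_ge_zero]]
        by (intro onorm_le) simp
    qed auto
    then show ?thesis by simp
  qed
  have gcont: "continuous_on UNIV g"
    using has_derivative_continuous[OF g] by (simp add: continuous_on_eq_continuous_at)
  have gmeas: "g \<in> borel_measurable borel" using gcont by (rule borel_measurable_continuous_onI)
  have gint: "integrable lborel g"
  proof (rule integrableI_bounded_set[where A="cball 0 R" and B="B * (2 * R)"])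
    show "emeasure lborel (cball (0::'a) R) < \<infinity>" by (intro emeasure_bounded_finite) auto
    \<comment> \<open>A zero of \<open>g\<close> on the sphere of radius \<open>R\<close>. Every
      point of the ball is within \<open>2 * R\<close> of it, so the Lipschitz estimate also bounds
      \<open>g\<close> itself.\<close>
    obtain z :: 'a where z: "norm z = R" using R(1) vector_choose_size less_imp_le by metis
    have gz: "g z = 0" using R z by force
    show "AE x\<in>cball 0 R in lborel. norm (g x) \<le> B * (2 * R)"
    proof (intro AE_I2 impI)
      fix x assume "x \<in> cball (0::'a) R"
      then have "norm (x - z) \<le> 2 * R" using norm_triangle_ineq4[of x z] z by simp
      then show "norm (g x) \<le> B * (2 * R)"
        using lip[of x z] gz B by (smt (verit) mult_left_mono real_norm_def)
    qed
  next
    show "AE x in lborel. x \<notin> cball 0 R \<longrightarrow> g x = 0" using R(2) by (intro AE_I2) force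
  qed (use gmeas in auto)
  \<comment> \<open>Increments that are positive and at most 1: all quotients then vanish outside
    the one ball of radius \<open>R + norm e\<close>.\<close>
  define h :: "nat \<Rightarrow> real" where "h n = 1 / real (Suc n)" for n
  have h: "h n > 0" "h n \<le> 1" for n by (auto simp: h_def)
  have h0: "h \<longlonglongrightarrow> 0" unfolding h_def by (rule LIMSEQ_Suc[OF lim_const_over_n])
  define s where "s n x = (g (h n *\<^sub>R e + x) - g x) / h n" for n x
  have trint: "integrable lborel (\<lambda>x. g (t + x))" "(LINT x|lborel. g (t + x)) = (LINT x|lborel. g x)" for t
  proof -
    have "integrable (distr lborel borel ((+) t)) g" using gint by (simp add: lborel_distr_plus)
    then show "integrable lborel (\<lambda>x. g (t + x))" by (subst (asm) integrable_distr_eq) (use gmeas in auto)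
    have "(LINT x|lborel. g x) = (LINT x|distr lborel borel ((+) t). g x)" by (simp add: lborel_distr_plus)
    also have "\<dots> = (LINT x|lborel. g (t + x))" by (subst integral_distr) (use gmeas in auto)
    finally show "(LINT x|lborel. g (t + x)) = (LINT x|lborel. g x)" by simp
  qed
  have s0: "(LINT x|lborel. s n x) = 0" for n
    unfolding s_def using trint gint by simp
  have "(\<lambda>n. LINT x|lborel. s n x) \<longlonglongrightarrow> (LINT x|lborel. dg x \<bullet> e)"
  proof (rule integral_dominated_convergence[where w="\<lambda>x. indicator (cball 0 (R + norm e)) x *\<^sub>R (B * norm e)"])
    show "(\<lambda>x. dg x \<bullet> e) \<in> borel_measurable lborel"
      using dg by (auto intro!: borel_measurable_continuous_onI continuous_intros)
    show "s n \<in> borel_measurable lborel" for n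
      unfolding s_def using trint(1) gint by (intro borel_measurable_integrable) auto
    show "integrable lborel (\<lambda>x. indicator (cball 0 (R + norm e)) x *\<^sub>R (B * norm e))"
      by (intro integrable_scaleR_left integrable_real_indicator emeasure_bounded_finite) auto
    show "AE x in lborel. (\<lambda>n. s n x) \<longlonglongrightarrow> dg x \<bullet> e"
    proof (rule AE_I2)
      fix x
      have "((\<lambda>t. x + t *\<^sub>R e) has_derivative (\<lambda>t. t *\<^sub>R e)) (at 0)"
        by (auto intro!: derivative_eq_intros)
      then have "((\<lambda>t. g (x + t *\<^sub>R e)) has_derivative (\<lambda>t. dg x \<bullet> (t *\<^sub>R e))) (at 0)"
        using has_derivative_compose[of "\<lambda>t. x + t *\<^sub>R e" "\<lambda>t. t *\<^sub>R e" 0 UNIV g "\<lambda>h. dg x \<bullet> h"] g[of x] by simp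
      then have "DERIV (\<lambda>t. g (x + t *\<^sub>R e)) 0 :> dg x \<bullet> e"
        by (simp add: has_field_derivative_def mult_commute_abs)
      then have "((\<lambda>t. (g (x + t *\<^sub>R e) - g x) / t) \<longlongrightarrow> dg x \<bullet> e) (at 0)"
        using DERIV_D by fastforce
      moreover have "filterlim h (at 0) sequentially"
        using h0 h by (auto simp: filterlim_at intro!: always_eventually order.strict_implies_not_eq[symmetric])
      ultimately show "(\<lambda>n. s n x) \<longlonglongrightarrow> dg x \<bullet> e"
        unfolding s_def using filterlim_compose by (fastforce simp: add.commute)
    qed
    show "AE x in lborel. norm (s n x) \<le> indicator (cball 0 (R + norm e)) x *\<^sub>R (B * norm e)" for n
    proof (rule AE_I2)
      fix x
      show "norm (s n x) \<le> indicator (cball 0 (R + norm e)) x *\<^sub>R (B * norm e)"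
      proof (cases "x \<in> cball 0 (R + norm e)")
        case True
        have "\<bar>g (h n *\<^sub>R e + x) - g x\<bar> \<le> B * (h n * norm e)"
          using lip[of "h n *\<^sub>R e + x" x] h[of n] by simp
        then show ?thesis using True h[of n] by (simp add: s_def field_simps)
      next
        case False
        have "norm (h n *\<^sub>R e) \<le> norm e" using h[of n] by (simp add: mult_left_le_one_le)
        then have "norm (h n *\<^sub>R e + x) > R"
          using False norm_triangle_ineq4[of "h n *\<^sub>R e + x" "h n *\<^sub>R e"] by simp
        moreover have "norm x > R" using False by (simp, smt (verit) norm_ge_zero)
        ultimately have "g (h n *\<^sub>R e + x) = 0" "g x = 0" using R(2) by force+
        then show ?thesis using False by (simp add: s_def)
      qed
    qed
  qed
  then show ?thesis using s0 LIMSEQ_unique[OF _ tendsto_const] by simp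
qed

text \<open>The open sets \<open>U\<close> and \<open>- K\<close> cover the space, and on their
  overlap \<open>f\<close> and hence \<open>df\<close> are 0. The values of \<open>f\<close> outside
  \<open>U\<close> are arbitrary, which is why the extension overwrites them.\<close>

lemma has_derivative_extend_by_zero:
  fixes f :: "'a::euclidean_space \<Rightarrow> real"
  assumes "open U" "closed K" "K \<subseteq> U"
    and f: "\<And>x. x \<in> U \<Longrightarrow> (f has_derivative (\<lambda>h. df x \<bullet> h)) (at x)"
    and df: "continuous_on U df"
    and z: "\<And>x. x \<in> U - K \<Longrightarrow> f x = 0"
  shows "((\<lambda>x. if x \<in> U then f x else 0) has_derivative (\<lambda>h. (if x \<in> U then df x else 0) \<bullet> h)) (at x)"
    and "continuous_on UNIV (\<lambda>x. if x \<in> U then df x else 0)"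
proof -
  have dz: "df x = 0" if "x \<in> U - K" for x
  proof -
    show ?thesis
      by (rule gradient_eq_0[OF f, where S="U - K"]) (use that assms in auto)
  qed
  show "((\<lambda>x. if x \<in> U then f x else 0) has_derivative (\<lambda>h. (if x \<in> U then df x else 0) \<bullet> h)) (at x)"
  proof (cases "x \<in> U")
    case True
    then show ?thesis
      using f[OF True] has_derivative_transform_within_open[OF f[OF True] \<open>open U\<close> True, of "\<lambda>x. if x \<in> U then f x else 0"]
      by simp
  next
    case False
    have "((\<lambda>x. if x \<in> U then f x else 0) has_derivative (\<lambda>h. 0)) (at x)"
      by (rule has_derivative_transform_within_open[of "\<lambda>_. 0" "\<lambda>_. 0" x UNIV "- K"])
        (use assms False in auto)
    then show ?thesis using False by simp
  qed
  have "continuous_on (U \<union> (- K)) (\<lambda>x. if x \<in> U then df x else 0)"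
  proof (rule continuous_on_open_Un)
    show "continuous_on U (\<lambda>x. if x \<in> U then df x else 0)"
      using df by (rule continuous_on_eq) auto
    show "continuous_on (- K) (\<lambda>x. if x \<in> U then df x else 0)"
      using continuous_on_const[of "-K" 0] by (rule continuous_on_eq) (use dz in auto)
  qed (use assms in auto)
  moreover have "U \<union> (- K) = UNIV" using assms by auto
  ultimately show "continuous_on UNIV (\<lambda>x. if x \<in> U then df x else 0)" by simp
qed

lemma set_integral_directional_derivative_eq_0:
  fixes f :: "'a::euclidean_space \<Rightarrow> real"
  assumes "open U" "compact K" "K \<subseteq> U"
    and f: "\<And>x. x \<in> U \<Longrightarrow> (f has_derivative (\<lambda>h. df x \<bullet> h)) (at x)"
    and df: "continuous_on U df"
    and z: "\<And>x. x \<in> U - K \<Longrightarrow> f x = 0"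
  shows "(LINT x:U|lborel. df x \<bullet> e) = 0"
proof -
  note ext = has_derivative_extend_by_zero[OF assms(1) compact_imp_closed[OF assms(2)] assms(3) f df z]
  have "{x. (if x \<in> U then f x else 0) \<noteq> 0} \<subseteq> K" using z by (auto split: if_splits)
  then have "bounded {x. (if x \<in> U then f x else 0) \<noteq> 0}"
    using assms(2) bounded_subset compact_imp_bounded by blast
  from integral_directional_derivative_eq_0[OF ext this, of e]
  have "(LINT x|lborel. (if x \<in> U then df x else 0) \<bullet> e) = 0" by simp
  moreover have "indicator U x *\<^sub>R (df x \<bullet> e) = (if x \<in> U then df x else 0) \<bullet> e" for x
    by (auto simp: indicator_def)
  ultimately show ?thesis by (simp add: set_lebesgue_integral_def)
qed

section \<open>Cutoffs near the boundary\<close>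

text \<open>A \<open>C\<^sup>1\<close> step, the second difference of the \<open>C\<^sup>1\<close> function \<open>(max 0 t)\<^sup>2 / 2\<close>.\<close>

definition step :: "real \<Rightarrow> real" where
  "step t = ((max 0 t)\<^sup>2 - 2 * (max 0 (t - 1))\<^sup>2 + (max 0 (t - 2))\<^sup>2) / 2"

text \<open>The hat function on the interval from 0 to 2 with peak 1 at 1; its area 1 is the height
  of \<open>step\<close>.\<close>

definition step_deriv :: "real \<Rightarrow> real" where
  "step_deriv t = max 0 t - 2 * max 0 (t - 1) + max 0 (t - 2)"

lemma DERIV_max_0_power2: "((\<lambda>t::real. (max 0 t)\<^sup>2) has_real_derivative 2 * max 0 t) (at t)"
proof -
  consider "t < 0" | "t = 0" | "t > 0" by linarith
  then show ?thesis
  proof cases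
    case 1
    have "((\<lambda>t::real. (max 0 t)\<^sup>2) has_real_derivative 0) (at t)"
      by (rule has_field_derivative_transform_within_open[OF DERIV_const, where S="{..<0}"]) (use 1 in auto)
    with 1 show ?thesis by simp
  next
    case 2
    have "((\<lambda>h. (max 0 h)\<^sup>2 / h) \<longlongrightarrow> (0::real)) (at 0)"
    proof (rule Lim_null_comparison)
      show "\<forall>\<^sub>F h in at (0::real). norm ((max 0 h)\<^sup>2 / h) \<le> \<bar>h\<bar>"
        by (rule always_eventually) (auto simp: max_def power2_eq_square)
      show "((\<lambda>h::real. \<bar>h\<bar>) \<longlongrightarrow> 0) (at 0)" by (rule tendsto_rabs_zero) (rule tendsto_ident_at)
    qed
    then show ?thesis using 2 by (simp add: DERIV_def)
  next
    case 3
    have "((\<lambda>t::real. (max 0 t)\<^sup>2) has_real_derivative 2 * t) (at t)"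
      by (rule has_field_derivative_transform_within_open[where S="{0<..}" and f="\<lambda>t. t\<^sup>2"])
         (use 3 in \<open>auto intro!: derivative_eq_intros\<close>)
    with 3 show ?thesis by simp
  qed
qed

lemma DERIV_step: "(step has_real_derivative step_deriv t) (at t)"
proof -
  have 1: "((\<lambda>t::real. (max 0 (t - a))\<^sup>2) has_real_derivative 2 * max 0 (t - a)) (at t)" for a
    using DERIV_chain2[where f="\<lambda>t::real. (max 0 t)\<^sup>2" and g="\<lambda>t. t - a", OF DERIV_max_0_power2]
      DERIV_diff[OF DERIV_ident DERIV_const] by fastforce
  show ?thesis unfolding step_def[abs_def] step_deriv_def
    by (rule derivative_eq_intros DERIV_max_0_power2 1 refl | simp)+
qed

lemma continuous_on_step_deriv: "continuous_on S step_deriv"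
  unfolding step_deriv_def[abs_def] by (intro continuous_intros)

lemma continuous_on_step: "continuous_on S step"
  unfolding step_def[abs_def] by (intro continuous_intros) auto

lemma step_deriv_nonneg: "0 \<le> step_deriv t" and step_deriv_le_1: "step_deriv t \<le> 1"
  by (auto simp: step_deriv_def max_def)

lemma step_deriv_eq_0: "t \<le> 0 \<Longrightarrow> step_deriv t = 0"
  by (auto simp: step_deriv_def max_def)

lemma step_eq_0: "t \<le> 0 \<Longrightarrow> step t = 0"
  by (auto simp: step_def max_def)

lemma step_eq_1: "t \<ge> 2 \<Longrightarrow> step t = 1"
  by (auto simp: step_def max_def power2_eq_square algebra_simps)

lemma step_nonneg: "0 \<le> step t" and step_le_1: "step t \<le> 1"
proof -
  have mono: "step s \<le> step t" if "s \<le> t" for s t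
    using that DERIV_step step_deriv_nonneg by (intro DERIV_nonneg_imp_nondecreasing[of s t step]) auto
  show "0 \<le> step t" using mono[of "min t 0" t] step_eq_0[of "min t 0"] by simp
  show "step t \<le> 1" using mono[of t "max t 2"] step_eq_1[of "max t 2"] by simp
qed

text \<open>A set \<open>S\<close> of boundary points can be cut off at the cost \<open>e\<close>; subadditive in \<open>S\<close>, like a capacity.\<close>

definition boundary_cutoff ::
    "'a::euclidean_space set \<Rightarrow> ('a \<Rightarrow> 'a) \<Rightarrow> 'a set \<Rightarrow> real \<Rightarrow> bool" where
  "boundary_cutoff \<Omega> v S e \<longleftrightarrow> (\<exists>q dq N. open N \<and> S \<subseteq> N \<and>
      (\<forall>x\<in>\<Omega>. (q has_derivative (\<lambda>h. dq x \<bullet> h)) (at x)) \<and> continuous_on \<Omega> dq \<and>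
      (\<forall>x\<in>\<Omega>. 0 \<le> q x \<and> q x \<le> 1) \<and> (\<forall>x\<in>\<Omega> \<inter> N. q x = 1) \<and>
      set_integrable lborel \<Omega> (\<lambda>x. q x + \<bar>v x \<bullet> dq x\<bar>) \<and>
      (LINT x:\<Omega>|lborel. q x + \<bar>v x \<bullet> dq x\<bar>) \<le> e)"

lemma boundary_cutoffE:
  assumes "boundary_cutoff \<Omega> v S e"
  obtains q dq N where "open N" "S \<subseteq> N"
    "\<And>x. x \<in> \<Omega> \<Longrightarrow> (q has_derivative (\<lambda>h. dq x \<bullet> h)) (at x)" "continuous_on \<Omega> dq"
    "\<And>x. x \<in> \<Omega> \<Longrightarrow> 0 \<le> q x" "\<And>x. x \<in> \<Omega> \<Longrightarrow> q x \<le> 1"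
    "\<And>x. x \<in> \<Omega> \<Longrightarrow> x \<in> N \<Longrightarrow> q x = 1"
    "set_integrable lborel \<Omega> (\<lambda>x. q x + \<bar>v x \<bullet> dq x\<bar>)"
    "(LINT x:\<Omega>|lborel. q x + \<bar>v x \<bullet> dq x\<bar>) \<le> e"
proof -
  obtain q dq N where A: "open N \<and> S \<subseteq> N \<and>
      (\<forall>x\<in>\<Omega>. (q has_derivative (\<lambda>h. dq x \<bullet> h)) (at x)) \<and> continuous_on \<Omega> dq \<and>
      (\<forall>x\<in>\<Omega>. 0 \<le> q x \<and> q x \<le> 1) \<and> (\<forall>x\<in>\<Omega> \<inter> N. q x = 1) \<and>
      set_integrable lborel \<Omega> (\<lambda>x. q x + \<bar>v x \<bullet> dq x\<bar>) \<and>
      (LINT x:\<Omega>|lborel. q x + \<bar>v x \<bullet> dq x\<bar>) \<le> e"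
    using assms unfolding boundary_cutoff_def by (elim exE)
  show thesis by (rule that[of N q dq]) (use A in \<open>simp_all\<close>)
qed

lemma boundary_cutoff_mono:
  "boundary_cutoff \<Omega> v T d \<Longrightarrow> S \<subseteq> T \<Longrightarrow> d \<le> e \<Longrightarrow> boundary_cutoff \<Omega> v S e"
  unfolding boundary_cutoff_def by (elim exE conjE, intro exI conjI) auto

lemma boundary_cutoff_empty: "0 \<le> e \<Longrightarrow> boundary_cutoff \<Omega> v {} e"
  unfolding boundary_cutoff_def
  by (rule exI[of _ "\<lambda>_. 0"], rule exI[of _ "\<lambda>_. 0"], rule exI[of _ "{}"])
    (simp add: set_integrable_def set_lebesgue_integral_def inner_zero_left[abs_def])

text \<open>\<open>1 - (1 - q) * (1 - p)\<close> is a differentiable substitute for the maximum: it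
  is 1 wherever \<open>q\<close> or \<open>p\<close> is, it is at most \<open>q + p\<close>, and its
  gradient combines \<open>dq\<close> and \<open>dp\<close> with weights between 0 and 1. Hence the
  costs add.\<close>

lemma boundary_cutoff_Un:
  assumes \<Omega>: "open \<Omega>" and v: "continuous_on \<Omega> v"
    and S: "boundary_cutoff \<Omega> v S d" and T: "boundary_cutoff \<Omega> v T e"
  shows "boundary_cutoff \<Omega> v (S \<union> T) (d + e)"
proof -
  obtain q dq M where q: "open M" "S \<subseteq> M"
    "\<And>x. x \<in> \<Omega> \<Longrightarrow> (q has_derivative (\<lambda>h. dq x \<bullet> h)) (at x)" "continuous_on \<Omega> dq"
    "\<And>x. x \<in> \<Omega> \<Longrightarrow> 0 \<le> q x" "\<And>x. x \<in> \<Omega> \<Longrightarrow> q x \<le> 1" "\<And>x. x \<in> \<Omega> \<Longrightarrow> x \<in> M \<Longrightarrow> q x = 1"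
    and qi: "set_integrable lborel \<Omega> (\<lambda>x. q x + \<bar>v x \<bullet> dq x\<bar>)"
    "(LINT x:\<Omega>|lborel. q x + \<bar>v x \<bullet> dq x\<bar>) \<le> d"
    by (rule boundary_cutoffE[OF S], rule that)
  obtain p dp N where p: "open N" "T \<subseteq> N"
    "\<And>x. x \<in> \<Omega> \<Longrightarrow> (p has_derivative (\<lambda>h. dp x \<bullet> h)) (at x)" "continuous_on \<Omega> dp"
    "\<And>x. x \<in> \<Omega> \<Longrightarrow> 0 \<le> p x" "\<And>x. x \<in> \<Omega> \<Longrightarrow> p x \<le> 1" "\<And>x. x \<in> \<Omega> \<Longrightarrow> x \<in> N \<Longrightarrow> p x = 1"
    and pi: "set_integrable lborel \<Omega> (\<lambda>x. p x + \<bar>v x \<bullet> dp x\<bar>)"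
    "(LINT x:\<Omega>|lborel. p x + \<bar>v x \<bullet> dp x\<bar>) \<le> e"
    by (rule boundary_cutoffE[OF T], rule that)
  define f where "f x = 1 - (1 - q x) * (1 - p x)" for x
  define df where "df x = (1 - p x) *\<^sub>R dq x + (1 - q x) *\<^sub>R dp x" for x
  have f: "(f has_derivative (\<lambda>h. df x \<bullet> h)) (at x)" if "x \<in> \<Omega>" for x
    unfolding f_def[abs_def] df_def
    by (rule derivative_eq_intros q(3)[OF that] p(3)[OF that] refl)+
      (simp add: inner_add_left algebra_simps)
  have cont: "continuous_on \<Omega> q" "continuous_on \<Omega> p"
    using q(3) p(3) has_derivative_continuous by (blast intro: continuous_at_imp_continuous_on)+
  have df: "continuous_on \<Omega> df"
    unfolding df_def[abs_def] using q(4) p(4) cont by (intro continuous_intros)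
  have cf: "continuous_on \<Omega> f"
    unfolding f_def[abs_def] using cont by (intro continuous_intros)
  have f01: "0 \<le> f x \<and> f x \<le> 1" if "x \<in> \<Omega>" for x
    using q(5,6)[OF that] p(5,6)[OF that] mult_le_one[of "1 - q x" "1 - p x"] by (simp add: f_def)
  have le: "f x + \<bar>v x \<bullet> df x\<bar> \<le> (q x + \<bar>v x \<bullet> dq x\<bar>) + (p x + \<bar>v x \<bullet> dp x\<bar>)" if "x \<in> \<Omega>" for x
  proof -
    have "f x \<le> q x + p x" using q(5)[OF that] p(5)[OF that] by (simp add: f_def algebra_simps)
    moreover have "\<bar>v x \<bullet> df x\<bar> \<le> \<bar>(1 - p x) * (v x \<bullet> dq x)\<bar> + \<bar>(1 - q x) * (v x \<bullet> dp x)\<bar>"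
      by (simp add: df_def inner_add_right)
    moreover have "\<bar>(1 - p x) * (v x \<bullet> dq x)\<bar> \<le> \<bar>v x \<bullet> dq x\<bar>" "\<bar>(1 - q x) * (v x \<bullet> dp x)\<bar> \<le> \<bar>v x \<bullet> dp x\<bar>"
      using q(5,6)[OF that] p(5,6)[OF that] by (auto simp: abs_mult intro!: mult_left_le_one_le)
    ultimately show ?thesis by linarith
  qed
  have i2: "set_integrable lborel \<Omega> (\<lambda>x. (q x + \<bar>v x \<bullet> dq x\<bar>) + (p x + \<bar>v x \<bullet> dp x\<bar>))"
    using qi(1) pi(1) by (rule set_integral_add)
  have i1: "set_integrable lborel \<Omega> (\<lambda>x. f x + \<bar>v x \<bullet> df x\<bar>)"
  proof (rule set_integrable_bound[OF i2])
    show "set_borel_measurable lborel \<Omega> (\<lambda>x. f x + \<bar>v x \<bullet> df x\<bar>)"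
      unfolding set_borel_measurable_def
      using borel_measurable_continuous_on_indicator[of \<Omega> "\<lambda>x. f x + \<bar>v x \<bullet> df x\<bar>"] \<Omega> cf df v
      by (simp add: continuous_intros)
    show "AE x in lborel. x \<in> \<Omega> \<longrightarrow> norm (f x + \<bar>v x \<bullet> df x\<bar>) \<le> norm ((q x + \<bar>v x \<bullet> dq x\<bar>) + (p x + \<bar>v x \<bullet> dp x\<bar>))"
      using le f01 by (intro AE_I2) force
  qed
  have "(LINT x:\<Omega>|lborel. f x + \<bar>v x \<bullet> df x\<bar>) \<le> (LINT x:\<Omega>|lborel. (q x + \<bar>v x \<bullet> dq x\<bar>) + (p x + \<bar>v x \<bullet> dp x\<bar>))"
    using i1 i2 le by (rule set_integral_mono)
  also have "\<dots> \<le> d + e"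
    using set_integral_add(2)[OF qi(1) pi(1)] qi(2) pi(2) by linarith
  finally have "(LINT x:\<Omega>|lborel. f x + \<bar>v x \<bullet> df x\<bar>) \<le> d + e" .
  then show ?thesis
    unfolding boundary_cutoff_def
    by (intro exI[of _ f] exI[of _ df] exI[of _ "M \<union> N"])
      (use q(1,2,7) p(1,2,7) f df f01 i1 in \<open>auto simp: f_def\<close>)
qed

lemma boundary_cutoff_UN:
  assumes "open \<Omega>" "continuous_on \<Omega> v" "finite I"
    and "\<And>i. i \<in> I \<Longrightarrow> boundary_cutoff \<Omega> v (S i) (e i)"
  shows "boundary_cutoff \<Omega> v (\<Union>i\<in>I. S i) (\<Sum>i\<in>I. e i)"
  using assms(3,4)
proof induction
  case empty
  then show ?case by (simp add: boundary_cutoff_empty)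
next
  case (insert i I)
  then have "boundary_cutoff \<Omega> v (S i \<union> (\<Union>i\<in>I. S i)) (e i + (\<Sum>i\<in>I. e i))"
    by (intro boundary_cutoff_Un assms(1,2)) auto
  with insert show ?case by simp
qed

text \<open>The argument of \<open>step\<close> is at least 2 exactly for
  \<open>norm (x - c) \<le> r\<close>, where the bump is 1, and at most 0 from distance sqrt 2 times
  \<open>r\<close> on, well inside the ball of radius \<open>2 * r\<close> used below. Squaring the
  norm avoids its singularity at the center.\<close>

definition bump :: "'a::euclidean_space \<Rightarrow> real \<Rightarrow> 'a \<Rightarrow> real" where
  "bump c r x = step (4 - 2 * (norm (x - c))\<^sup>2 / r\<^sup>2)"

definition bump_grad :: "'a::euclidean_space \<Rightarrow> real \<Rightarrow> 'a \<Rightarrow> 'a" where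
  "bump_grad c r x = (step_deriv (4 - 2 * (norm (x - c))\<^sup>2 / r\<^sup>2) * (- 4 / r\<^sup>2)) *\<^sub>R (x - c)"

lemma has_derivative_step_compose:
  assumes "(g has_derivative (\<lambda>h. d \<bullet> h)) (at x)"
  shows "((\<lambda>x. step (g x)) has_derivative (\<lambda>h. (step_deriv (g x) *\<^sub>R d) \<bullet> h)) (at x)"
  using has_derivative_compose[OF assms, of step "(*) (step_deriv (g x))"]
    DERIV_step[of "g x"] by (simp add: has_field_derivative_def)

lemma has_derivative_bump: "(bump c r has_derivative (\<lambda>h. bump_grad c r x \<bullet> h)) (at x)"
proof -
  have "((\<lambda>x. 4 - 2 * (norm (x - c))\<^sup>2 / r\<^sup>2) has_derivative (\<lambda>h. ((- 4 / r\<^sup>2) *\<^sub>R (x - c)) \<bullet> h)) (at x)"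
    unfolding power2_norm_eq_inner
    by (auto intro!: derivative_eq_intros simp: inner_commute divide_inverse algebra_simps)
  from has_derivative_step_compose[OF this] show ?thesis
    unfolding bump_def[abs_def] bump_grad_def by simp
qed

lemma continuous_on_bump_grad: "continuous_on S (bump_grad c r)"
  unfolding bump_grad_def[abs_def] divide_inverse
  by (intro continuous_intros continuous_on_compose2[OF continuous_on_step_deriv[of UNIV]]) auto

lemma continuous_on_bump: "continuous_on S (bump c r)"
  by (intro continuous_at_imp_continuous_on ballI has_derivative_continuous[OF has_derivative_bump])

lemma bump_nonneg: "0 \<le> bump c r x" and bump_le_1: "bump c r x \<le> 1"
  by (auto simp: bump_def step_nonneg step_le_1)

lemma bump_eq_1:
  assumes "x \<in> cball c r" "r > 0" shows "bump c r x = 1"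
proof -
  have "(norm (x - c))\<^sup>2 \<le> r\<^sup>2" using assms by (intro power_mono) (auto simp: dist_norm norm_minus_commute)
  then show ?thesis unfolding bump_def using assms by (intro step_eq_1) (simp add: field_simps)
qed

lemma bump_arg_le_0:
  assumes "x \<notin> ball c (2 * r)" "r > 0" shows "4 - 2 * (norm (x - c))\<^sup>2 / r\<^sup>2 \<le> 0"
proof -
  have "(2 * r)\<^sup>2 \<le> (norm (x - c))\<^sup>2"
    using assms by (intro power_mono) (auto simp: dist_norm norm_minus_commute)
  moreover have "(2 * r)\<^sup>2 = 4 * r\<^sup>2" by (simp add: power_mult_distrib)
  ultimately have "4 * r\<^sup>2 \<le> 2 * (norm (x - c))\<^sup>2"
    using zero_le_power2[of "norm (x - c)"] by linarith
  then show ?thesis using assms by (simp add: field_simps)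
qed

lemma bump_eq_0: "x \<notin> ball c (2 * r) \<Longrightarrow> r > 0 \<Longrightarrow> bump c r x = 0"
  unfolding bump_def by (intro step_eq_0 bump_arg_le_0)

lemma norm_bump_grad:
  assumes "r > 0" shows "norm (bump_grad c r x) \<le> indicator (ball c (2 * r)) x * (8 / r)"
proof (cases "x \<in> ball c (2 * r)")
  case True
  then have "norm (x - c) \<le> 2 * r" by (simp add: dist_norm norm_minus_commute)
  have "norm (bump_grad c r x) = step_deriv (4 - 2 * (norm (x - c))\<^sup>2 / r\<^sup>2) * (4 / r\<^sup>2 * norm (x - c))"
    by (simp add: bump_grad_def abs_mult step_deriv_nonneg)
  also have "\<dots> \<le> 1 * (4 / r\<^sup>2 * norm (x - c))"
    by (intro mult_right_mono step_deriv_le_1) auto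
  also have "\<dots> \<le> 4 / r\<^sup>2 * (2 * r)" using \<open>norm (x - c) \<le> 2 * r\<close>
    by (simp only: mult_1) (intro mult_left_mono, auto)
  also have "\<dots> = 8 / r" using assms by (simp add: power2_eq_square)
  finally show ?thesis using True by simp
next
  case False
  then show ?thesis using assms bump_arg_le_0[OF False assms] by (simp add: bump_grad_def step_deriv_eq_0)
qed

text \<open>The integrand is at most \<open>(1 + 8 * V) / r\<close> and lives on a ball of radius
  \<open>2 * r\<close>, so the gradient costs one power of \<open>r\<close> against the volume. The
  bump itself is bounded by 1, which is at most \<open>1 / r\<close> because
  \<open>r \<le> 1\<close>.\<close>

lemma boundary_cutoff_ball:
  fixes \<Omega> :: "'a::euclidean_space set"
  assumes \<Omega>: "open \<Omega>" "bounded \<Omega>" and v: "continuous_on \<Omega> v" "\<And>x. x \<in> \<Omega> \<Longrightarrow> norm (v x) \<le> V"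
    and V: "0 \<le> V" and r: "0 < r" "r \<le> 1"
  shows "boundary_cutoff \<Omega> v (ball c r) ((1 + 8 * V) * 2 ^ DIM('a) * measure lborel (ball (0::'a) 1) * r ^ (DIM('a) - 1))"
proof -
  let ?f = "\<lambda>x. bump c r x + \<bar>v x \<bullet> bump_grad c r x\<bar>"
  define k where "k = (1 + 8 * V) / r"
  have le: "?f x \<le> indicator (ball c (2 * r)) x * k" if "x \<in> \<Omega>" for x
  proof -
    have "\<bar>v x \<bullet> bump_grad c r x\<bar> \<le> norm (v x) * norm (bump_grad c r x)" by (rule Cauchy_Schwarz_ineq2)
    also have "\<dots> \<le> V * (indicator (ball c (2 * r)) x * (8 / r))"
      using v(2)[OF that] norm_bump_grad[OF r(1)] V by (intro mult_mono) auto
    finally have 1: "\<bar>v x \<bullet> bump_grad c r x\<bar> \<le> V * (indicator (ball c (2 * r)) x * (8 / r))" .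
    have "bump c r x \<le> indicator (ball c (2 * r)) x * (1 / r)"
    proof (cases "x \<in> ball c (2 * r)")
      case True
      have "1 \<le> 1 / r" using r by simp
      then show ?thesis using True bump_le_1[of c r x] by (simp del: le_divide_eq_1)
    qed (simp add: bump_eq_0[OF _ r(1)])
    then show ?thesis using 1 by (simp add: k_def field_simps add_divide_distrib)
  qed
  have bd: "norm (?f x) \<le> \<bar>k\<bar>" if "x \<in> \<Omega>" for x
    using le[OF that] bump_nonneg[of c r x] by (cases "x \<in> ball c (2 * r)") auto
  have int: "set_integrable lborel \<Omega> ?f"
  proof (rule set_integrable_bounded_continuous[OF \<Omega>])
    show "continuous_on \<Omega> ?f" using v by (intro continuous_intros continuous_on_bump continuous_on_bump_grad)
    show "bounded (?f ` \<Omega>)" using bd by (auto simp: bounded_iff)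
  qed
  have "(LINT x:\<Omega>|lborel. ?f x) \<le> (LINT x|lborel. indicator (ball c (2 * r)) x * k)"
    unfolding set_lebesgue_integral_def
  proof (rule integral_mono)
    show "integrable lborel (\<lambda>x. indicator \<Omega> x *\<^sub>R ?f x)" using int by (simp add: set_integrable_def)
    show "integrable lborel (\<lambda>x. indicator (ball c (2 * r)) x * k)"
      by (intro integrable_mult_left integrable_real_indicator emeasure_bounded_finite) auto
    show "indicator \<Omega> x *\<^sub>R ?f x \<le> indicator (ball c (2 * r)) x * k" for x
      using le[of x] V r by (auto simp: indicator_def k_def)
  qed
  also have "\<dots> = measure lborel (ball c (2 * r)) * k" by simp
  also have "\<dots> = (2 * r) ^ DIM('a) * measure lborel (ball (0::'a) 1) * k"
    using content_ball_conv_unit_ball[of "2 * r" c] r by simp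
  also have "(2 * r) ^ DIM('a) = 2 ^ DIM('a) * r ^ (DIM('a) - 1) * r"
    using DIM_positive[where 'a='a] by (cases "DIM('a)") (auto simp: power_mult_distrib)
  finally have "(LINT x:\<Omega>|lborel. ?f x) \<le> (1 + 8 * V) * 2 ^ DIM('a) * measure lborel (ball (0::'a) 1) * r ^ (DIM('a) - 1)"
    using r by (simp add: k_def mult_ac)
  then show ?thesis
    unfolding boundary_cutoff_def
    by (intro exI[of _ "bump c r"] exI[of _ "bump_grad c r"] exI[of _ "ball c r"])
      (use int r in \<open>auto simp: has_derivative_bump continuous_on_bump_grad bump_nonneg bump_le_1 bump_eq_1\<close>)
qed

section \<open>Cutoffs at regular boundary points and on the whole frontier\<close>

lemma has_derivative_grad:
  assumes "f differentiable (at x)"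
  shows "(f has_derivative (\<lambda>h. grad f x \<bullet> h)) (at x)"
proof -
  let ?D = "frechet_derivative f (at x)"
  have D: "(f has_derivative ?D) (at x)" using assms by (simp add: frechet_derivative_works)
  then have lin: "linear ?D" by (rule has_derivative_linear)
  have "?D h = grad f x \<bullet> h" for h
  proof -
    have "?D h = ?D (\<Sum>i\<in>Basis. (h \<bullet> i) *\<^sub>R i)" by (simp add: euclidean_representation)
    also have "\<dots> = grad f x \<bullet> h"
      by (simp add: linear_sum[OF lin] linear_scale[OF lin] grad_def partial_def inner_sum_left inner_sum_right inner_commute mult.commute)
    finally show ?thesis .
  qed
  with D show ?thesis by (metis ext)
qed

lemma integrable_compact_support:
  fixes f :: "'a::euclidean_space \<Rightarrow> 'b::euclidean_space"
  assumes "compact K" "continuous_on K f" "\<And>x. x \<notin> K \<Longrightarrow> f x = 0"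
  shows "integrable lborel f"
proof -
  have "integrable lborel (\<lambda>x. indicator K x *\<^sub>R f x)"
    using assms by (intro borel_integrable_compact)
  moreover have "(\<lambda>x. indicator K x *\<^sub>R f x) = f"
    using assms(3) by (auto simp: indicator_def)
  ultimately show ?thesis by simp
qed

lemma continuous_on_extend_by_zero:
  fixes f :: "'a::topological_space \<Rightarrow> 'b::real_normed_vector"
  assumes "open U" "closed K" "K \<subseteq> U" "continuous_on U f" "\<And>x. x \<notin> K \<Longrightarrow> f x = 0"
  shows "continuous_on UNIV f"
proof -
  have "continuous_on (- K) f"
    using continuous_on_const[of "-K" 0] by (rule continuous_on_eq) (use assms in auto)
  then have "continuous_on (U \<union> - K) f"
    using assms by (intro continuous_on_open_Un) auto
  moreover have "U \<union> - K = UNIV" using assms by auto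
  ultimately show ?thesis by simp
qed

text \<open>The gradient of the cutoff splits into \<open>p n\<close>, which is bounded uniformly in
  \<open>n\<close> and tends to 0 pointwise in the domain, and \<open>k n\<close> times
  \<open>grad r\<close>, where \<open>k n\<close> is large but has an integral bounded uniformly in
  \<open>n\<close>. The radius \<open>s\<close> comes before \<open>e\<close>, so that a finite
  cover can be chosen first and the cost distributed over it afterwards.\<close>

lemma boundary_cutoff_regular:
  fixes \<Omega> :: "'a::euclidean_space set"
  assumes \<Omega>: "open \<Omega>" "bounded \<Omega>"
    and v: "uniformly_continuous_on \<Omega> v"
    and normal: "\<And>x \<nu>. x \<in> frontier \<Omega> \<Longrightarrow> outward_unit_normal \<Omega> x \<nu> \<Longrightarrow>
      ((\<lambda>y. v y \<bullet> \<nu>) \<longlongrightarrow> 0) (at x within \<Omega>)"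
    and x0: "x0 \<in> frontier \<Omega>" "outward_unit_normal \<Omega> x0 \<nu>0"
  shows "\<exists>s>0. \<forall>e>0. boundary_cutoff \<Omega> v (frontier \<Omega> \<inter> ball x0 s) e"
proof -
  obtain U r where R: "open U \<and> x0 \<in> U \<and>
      r differentiable_on U \<and> continuous_on U (grad r) \<and> (\<forall>y\<in>U. grad r y \<noteq> 0) \<and>
      \<Omega> \<inter> U = {y \<in> U. r y < 0} \<and> r x0 = 0 \<and> \<nu>0 = grad r x0 /\<^sub>R norm (grad r x0)"
    using x0(2) unfolding outward_unit_normal_def by (elim exE)
  then have U: "open U" "x0 \<in> U" and rd: "r differentiable_on U"
    and dr: "continuous_on U (grad r)" and dr0: "\<And>y. y \<in> U \<Longrightarrow> grad r y \<noteq> 0"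
    and sub: "\<Omega> \<inter> U = {y \<in> U. r y < 0}"
    by blast+
  have r': "(r has_derivative (\<lambda>h. grad r y \<bullet> h)) (at y)" if "y \<in> U" for y
    by (rule has_derivative_grad) (metis rd that U(1) differentiable_on_def at_within_open)
  have rc: "continuous_on U r" using rd by (rule differentiable_imp_continuous_on)
  have rneg: "r y < 0" if "y \<in> \<Omega>" "y \<in> U" for y
    using equalityD1[OF sub] that by blast
  \<comment> \<open>With \<open>r y < 0\<close> the point would lie in the open set \<Omega>, which
    contains no frontier point; with \<open>r y > 0\<close> nearby points of \<Omega> would have
    positive \<open>r\<close> as well.\<close>
  have rf: "r y = 0" if "y \<in> frontier \<Omega>" "y \<in> U" for y
  proof (rule ccontr)
    assume "r y \<noteq> 0"
    moreover have "y \<notin> \<Omega>" using that(1) \<Omega>(1) by (auto simp: frontier_def interior_open)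
    moreover have "\<not> r y < 0" using equalityD2[OF sub] \<open>y \<notin> \<Omega>\<close> that(2) by blast
    ultimately have "r y > 0" by linarith
    have "open (U \<inter> r -` {0<..})"
      using rc U(1) by (intro continuous_open_preimage) auto
    moreover have "y \<in> closure \<Omega>" using that(1) by (simp add: frontier_def)
    moreover have "y \<in> U \<inter> r -` {0<..}" using \<open>r y > 0\<close> that(2) by simp
    ultimately obtain z where "z \<in> \<Omega>" "z \<in> U \<inter> r -` {0<..}"
      using open_Int_closure_eq_empty[of "U \<inter> r -` {0<..}" \<Omega>] by blast
    then show False using rneg by force
  qed
  \<comment> \<open>The same \<open>r\<close> is a defining function at every frontier point in
    \<open>U\<close>, so the boundary condition applies at all of them and not only at
    \<open>x0\<close>.\<close>
  have normal': "((\<lambda>x. v x \<bullet> grad r y) \<longlongrightarrow> 0) (at y within \<Omega>)" if "y \<in> frontier \<Omega>" "y \<in> U" for y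
  proof -
    have "outward_unit_normal \<Omega> y (grad r y /\<^sub>R norm (grad r y))"
      unfolding outward_unit_normal_def
      using U(1) that(2) rd dr dr0 sub rf[OF that]
      by (intro exI[of _ U] exI[of _ r] conjI) simp_all
    from tendsto_mult_right_zero[OF normal[OF that(1) this], of "norm (grad r y)"]
    show ?thesis using dr0[OF that(2)] by (simp add: mult.assoc[symmetric])
  qed
  \<comment> \<open>The condition on \<open>v\<close> is a limit at each single boundary point.
    Extending \<open>v\<close> continuously to the closure turns it into the equation
    \<open>wf\<close>, from which compactness extracts a uniform bound.\<close>
  obtain w where w: "uniformly_continuous_on (closure \<Omega>) w" "\<And>x. x \<in> \<Omega> \<Longrightarrow> v x = w x"
    by (rule uniformly_continuous_on_extension_on_closure[OF v], rule that)
  have wc: "continuous_on (closure \<Omega>) w" using w(1) by (rule uniformly_continuous_imp_continuous)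
  have wf: "w y \<bullet> grad r y = 0" if "y \<in> frontier \<Omega>" "y \<in> U" for y
  proof -
    have y: "y \<in> closure \<Omega>" "y \<notin> \<Omega>" using that(1) \<Omega>(1) by (auto simp: frontier_def interior_open)
    have "(w \<longlongrightarrow> w y) (at y within \<Omega>)"
      using wc y(1) closure_subset by (metis continuous_on_def tendsto_within_subset)
    then have "((\<lambda>x. w x \<bullet> grad r y) \<longlongrightarrow> w y \<bullet> grad r y) (at y within \<Omega>)"
      by (intro tendsto_intros)
    moreover have "((\<lambda>x. w x \<bullet> grad r y) \<longlongrightarrow> 0) (at y within \<Omega>)"
      using normal'[OF that] by (rule Lim_transform_within[where d=1]) (use w(2) in auto)
    moreover have "at y within \<Omega> \<noteq> bot"
      using y by (simp add: trivial_limit_within islimpt_in_closure)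
    ultimately show ?thesis using tendsto_unique by blast
  qed
  have "bounded (v ` \<Omega>)" using v \<Omega>(2) by (rule bounded_uniformly_continuous_image)
  then obtain V where V: "V > 0" "\<And>x. x \<in> \<Omega> \<Longrightarrow> norm (v x) \<le> V" by (auto simp: bounded_pos)
  have vc: "continuous_on \<Omega> v" using v by (rule uniformly_continuous_imp_continuous)

  \<comment> \<open>The direction of transversality: near \<open>x0\<close> the gradient of
    \<open>r\<close> keeps a component along \<open>e\<close> of at least \<open>c\<close>, half of
    its value at \<open>x0\<close>.\<close>
  define e where "e = grad r x0"
  define c where "c = (norm e)\<^sup>2 / 2"
  have c: "c > 0" using dr0[OF U(2)] by (simp add: c_def e_def)
  have "continuous_on U (\<lambda>x. grad r x \<bullet> e)" using dr by (intro continuous_intros)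
  then have "open (U \<inter> (\<lambda>x. grad r x \<bullet> e) -` {c<..})"
    using U(1) by (intro continuous_open_preimage) auto
  moreover have "grad r x0 \<bullet> e > c" using c by (simp add: c_def e_def power2_norm_eq_inner)
  ultimately obtain t where t: "t > 0" "cball x0 t \<subseteq> U \<inter> (\<lambda>x. grad r x \<bullet> e) -` {c<..}"
    using U(2) unfolding open_contains_cball by blast
  \<comment> \<open>The bump of radius \<open>s\<close> is supported in the ball of radius
    \<open>2 * s = t\<close>, on which \<open>r\<close> and the lower bound \<open>c\<close> are
    available.\<close>
  define s where "s = t / 2"
  define K where "K = cball x0 (2 * s)"
  have s: "s > 0" and KU: "K \<subseteq> U" and Kc: "\<And>x. x \<in> K \<Longrightarrow> grad r x \<bullet> e \<ge> c"
    using t by (auto simp: s_def K_def less_imp_le)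
  have K: "compact K" "closed K" by (auto simp: K_def)
  have b0: "bump x0 s x = 0" "bump_grad x0 s x = 0" if "x \<notin> K" for x
    using that s bump_eq_0[of x x0 s] norm_bump_grad[of s x0 x] by (auto simp: K_def)

  \<comment> \<open>The second factor is 1 for \<open>r x \<ge> - 2 / n\<close> and 0 for
    \<open>r x \<le> - 4 / n\<close>. The offset 4 exceeds the threshold 2 of \<open>step\<close>,
    so the cutoff is 1 on an open neighbourhood of the nearby frontier, where \<open>r\<close> is
    0.\<close>
  define q where "q n x = bump x0 s x * step (4 + real n * r x)" for n x
  define k where "k n x = bump x0 s x * (real n * step_deriv (4 + real n * r x))" for n x
  define p where "p n x = step (4 + real n * r x) *\<^sub>R bump_grad x0 s x" for n x
  define dq where "dq n x = p n x + k n x *\<^sub>R grad r x" for n x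
  have z: "q n x = 0" "k n x = 0" "p n x = 0" "dq n x = 0" if "x \<notin> K" for n x
    using b0[OF that] by (simp_all add: q_def k_def p_def dq_def)
  have kU: "continuous_on U (k n)" for n
    unfolding k_def[abs_def] using rc
    by (intro continuous_intros continuous_on_bump continuous_on_compose2[OF continuous_on_step_deriv[of UNIV]]) auto
  have pU: "continuous_on U (p n)" for n
    unfolding p_def[abs_def] using rc
    by (intro continuous_intros continuous_on_bump_grad continuous_on_compose2[OF continuous_on_step[of UNIV]]) auto
  have dqU: "continuous_on U (dq n)" for n
    unfolding dq_def[abs_def] using kU pU dr by (intro continuous_intros)
  note ext = continuous_on_extend_by_zero[OF U(1) K(2) KU]
  have kC: "continuous_on UNIV (k n)" for n using kU z(2) by (rule ext)
  have pC: "continuous_on UNIV (p n)" for n using pU z(3) by (rule ext)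
  have dqC: "continuous_on UNIV (dq n)" for n using dqU z(4) by (rule ext)
  have q': "(q n has_derivative (\<lambda>h. dq n x \<bullet> h)) (at x)" for n x
  proof (cases "x \<in> U")
    case True
    have "((\<lambda>x. 4 + real n * r x) has_derivative (\<lambda>h. (real n *\<^sub>R grad r x) \<bullet> h)) (at x)"
      by (auto intro!: derivative_eq_intros r'[OF True])
    note has_derivative_mult[OF has_derivative_bump[of x0 s x] has_derivative_step_compose[OF this]]
    then show ?thesis
      by (simp add: q_def[abs_def] dq_def p_def k_def inner_add_left mult_ac add_ac)
  next
    case False
    have "(q n has_derivative (\<lambda>h. 0)) (at x)"
      by (rule has_derivative_transform_within_open[of "\<lambda>_. 0" "\<lambda>_. 0" x UNIV "- K"])
        (use K KU False z in auto)
    moreover have "x \<notin> K" using False KU by blast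
    then have "(\<lambda>h. dq n x \<bullet> h) = (\<lambda>h. 0)" by (simp add: z fun_eq_iff)
    ultimately show ?thesis by simp
  qed
  have qC: "continuous_on UNIV (q n)" for n
    using has_derivative_continuous[OF q'] by (simp add: continuous_on_eq_continuous_at)
  have kint: "integrable lborel (k n)" for n
    using K(1) kC z by (intro integrable_compact_support[where K=K]) (auto intro: continuous_on_subset)
  have k0: "k n x \<ge> 0" for n x
    by (simp add: k_def bump_nonneg step_deriv_nonneg)

  \<comment> \<open>\<open>8 / s\<close> bounds the gradient of the bump on its ball, and the
    division by \<open>c\<close> undoes the factor gained from \<open>grad r x . e\<close>;
    \<open>n\<close> does not enter.\<close>
  define C where "C = measure lborel (ball x0 (2 * s)) * (8 / s * norm e) / c"
  have C: "C \<ge> 0" using s c by (simp add: C_def)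
  \<comment> \<open>\<open>k n\<close> is of order \<open>n\<close> on a strip, but \<open>dq n \<bullet> e\<close> has integral 0 and \<open>grad r \<bullet> e \<ge> c\<close>.\<close>
  have kC_le: "(LINT x|lborel. k n x) \<le> C" for n
  proof -
    have i1: "integrable lborel (\<lambda>x. p n x \<bullet> e)"
      using K(1) pC[of n] z by (intro integrable_compact_support[where K=K])
        (auto intro: continuous_on_subset intro!: continuous_intros)
    have i2: "integrable lborel (\<lambda>x. k n x * (grad r x \<bullet> e))"
      using K(1) kC[of n] z continuous_on_subset[OF dr KU]
      by (intro integrable_compact_support[where K=K])
        (auto intro: continuous_on_subset intro!: continuous_intros)
    have "(LINT x|lborel. dq n x \<bullet> e) = 0"
    proof (rule integral_directional_derivative_eq_0[OF q' dqC])
      have "{x. q n x \<noteq> 0} \<subseteq> K" using z by blast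
      then show "bounded {x. q n x \<noteq> 0}" using K(1) bounded_subset compact_imp_bounded by blast
    qed
    then have "(LINT x|lborel. p n x \<bullet> e) + (LINT x|lborel. k n x * (grad r x \<bullet> e)) = 0"
      using i1 i2 by (simp add: dq_def inner_add_left)
    moreover have "(LINT x|lborel. c * k n x) \<le> (LINT x|lborel. k n x * (grad r x \<bullet> e))"
    proof (rule integral_mono[OF _ i2])
      show "c * k n x \<le> k n x * (grad r x \<bullet> e)" for x
        using mult_right_mono[OF Kc k0, of x n x] z(2)[of x n]
        by (cases "x \<in> K") (simp_all add: mult.commute)
    qed (use kint in auto)
    moreover have "(LINT x|lborel. - (p n x \<bullet> e)) \<le> (LINT x|lborel. indicator (ball x0 (2 * s)) x * (8 / s * norm e))"
    proof (rule integral_mono)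
      show "integrable lborel (\<lambda>x. indicator (ball x0 (2 * s)) x * (8 / s * norm e))"
        by (intro integrable_mult_left integrable_real_indicator emeasure_bounded_finite) auto
      show "- (p n x \<bullet> e) \<le> indicator (ball x0 (2 * s)) x * (8 / s * norm e)" for x
      proof -
        have "- (p n x \<bullet> e) \<le> norm (p n x) * norm e"
          using Cauchy_Schwarz_ineq2[of "p n x" e] by linarith
        also have "norm (p n x) \<le> 1 * norm (bump_grad x0 s x)"
          unfolding p_def norm_scaleR by (intro mult_right_mono) (auto simp: step_nonneg step_le_1)
        also have "\<dots> \<le> indicator (ball x0 (2 * s)) x * (8 / s)" using norm_bump_grad[OF s] by simp
        finally show ?thesis by (simp add: mult_right_mono)
      qed
    qed (use i1 in auto)
    ultimately have "c * (LINT x|lborel. k n x) \<le> measure lborel (ball x0 (2 * s)) * (8 / s * norm e)"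
      using i1 by simp
    then show ?thesis unfolding C_def using c by (simp only: pos_le_divide_eq mult.commute)
  qed

  \<comment> \<open>The points of \<open>closure \<Omega> \<inter> K\<close> where the product is at
    least \<open>d\<close> form a compact set \<open>L\<close>. It misses the frontier because the
    product vanishes there, so \<open>r\<close> has a negative maximum on \<open>L\<close>, and
    above that level the product is small.\<close>
  have strip: "\<exists>h>0. \<forall>x\<in>\<Omega> \<inter> K. r x > - h \<longrightarrow> \<bar>v x \<bullet> grad r x\<bar> \<le> d" if d: "d > 0" for d
  proof -
    define L where "L = {x \<in> closure \<Omega> \<inter> K. \<bar>w x \<bullet> grad r x\<bar> \<ge> d}"
    have cont: "continuous_on (closure \<Omega> \<inter> K) (\<lambda>x. \<bar>w x \<bullet> grad r x\<bar>)"
      using continuous_on_subset[OF wc, of "closure \<Omega> \<inter> K"] continuous_on_subset[OF dr, of "closure \<Omega> \<inter> K"] KU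
      by (intro continuous_intros) auto
    have "closed (closure \<Omega> \<inter> K \<inter> (\<lambda>x. \<bar>w x \<bullet> grad r x\<bar>) -` {d..})"
      using K by (intro continuous_closed_preimage cont) auto
    then have "closed L" unfolding L_def vimage_def by (simp add: Int_def)
    moreover have "K \<inter> L = L" by (auto simp: L_def)
    ultimately have L: "compact L" using compact_Int_closed[OF K(1)] by metis
    have Lneg: "r x < 0" if "x \<in> L" for x
    proof -
      have x: "x \<in> closure \<Omega>" "x \<in> U" using that KU by (auto simp: L_def)
      have "x \<in> \<Omega>"
      proof (rule ccontr)
        assume "x \<notin> \<Omega>"
        then have "x \<in> frontier \<Omega>" using x \<Omega>(1) by (simp add: frontier_def interior_open)
        then show False using wf x(2) that d by (simp add: L_def)
      qed
      then show ?thesis using rneg x(2) by blast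
    qed
    show ?thesis
    proof (cases "L = {}")
      case True
      then have "\<bar>v x \<bullet> grad r x\<bar> \<le> d" if "x \<in> \<Omega> \<inter> K" for x
        using that w(2)[of x] closure_subset[of \<Omega>] by (force simp: L_def)
      then show ?thesis by (intro exI[of _ 1]) auto
    next
      case False
      have "continuous_on L r" using rc KU by (auto simp: L_def intro: continuous_on_subset)
      then obtain m where m: "m \<in> L" "\<And>x. x \<in> L \<Longrightarrow> r x \<le> r m"
        using continuous_attains_sup[OF L False] by blast
      have "\<bar>v x \<bullet> grad r x\<bar> \<le> d" if "x \<in> \<Omega> \<inter> K" "r x > r m" for x
      proof -
        have "x \<notin> L" using m(2)[of x] that(2) by auto
        then show ?thesis using that(1) w(2)[of x] closure_subset[of \<Omega>] by (force simp: L_def)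
      qed
      then show ?thesis using Lneg[OF m(1)] by (intro exI[of _ "- r m"]) auto
    qed
  qed

  \<comment> \<open>The part of the cost with a bounded gradient. At a fixed point of the domain
    \<open>r x < 0\<close>, so \<open>4 + n * r x\<close> is eventually nonpositive and the
    integrand is 0 from then on.\<close>
  define f where "f n x = q n x + \<bar>v x \<bullet> p n x\<bar>" for n x
  have q01: "0 \<le> q n x" "q n x \<le> 1" for n x
    by (auto simp: q_def bump_nonneg bump_le_1 step_nonneg step_le_1 intro: mult_le_one)
  have fmeas: "(\<lambda>x. indicator \<Omega> x *\<^sub>R f n x) \<in> borel_measurable lborel" for n
    unfolding f_def using borel_measurable_continuous_on_indicator[of \<Omega> "\<lambda>x. q n x + \<bar>v x \<bullet> p n x\<bar>"] \<Omega>(1) vc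
      continuous_on_subset[OF qC] continuous_on_subset[OF pC]
    by (simp add: continuous_intros)
  have fb: "norm (f n x) \<le> 1 + V * (8 / s)" if "x \<in> \<Omega>" for n x
  proof -
    have "norm (p n x) \<le> 1 * norm (bump_grad x0 s x)"
      unfolding p_def norm_scaleR by (intro mult_right_mono) (auto simp: step_nonneg step_le_1)
    also have "\<dots> \<le> 8 / s" using norm_bump_grad[OF s, of x0 x] s
      by (cases "x \<in> ball x0 (2 * s)") auto
    finally have "norm (p n x) \<le> 8 / s" .
    then have "norm (v x) * norm (p n x) \<le> V * (8 / s)"
      using V(2)[OF that] V(1) by (intro mult_mono) auto
    then show ?thesis using Cauchy_Schwarz_ineq2[of "v x" "p n x"] q01[of n x] by (simp add: f_def)
  qed
  have bint: "integrable lborel (\<lambda>x. indicator \<Omega> x *\<^sub>R (1 + V * (8 / s)))"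
    using \<Omega> by (intro integrable_scaleR_left integrable_real_indicator emeasure_bounded_finite) auto
  have flim: "(\<lambda>n. LINT x:\<Omega>|lborel. f n x) \<longlonglongrightarrow> 0"
  proof -
    have "(\<lambda>n. LINT x|lborel. indicator \<Omega> x *\<^sub>R f n x) \<longlonglongrightarrow> (LINT x|(lborel :: 'a measure). (0::real))"
    proof (rule integral_dominated_convergence[where w="\<lambda>x. indicator \<Omega> x *\<^sub>R (1 + V * (8 / s))"])
      show "AE x in lborel. norm (indicator \<Omega> x *\<^sub>R f n x) \<le> indicator \<Omega> x *\<^sub>R (1 + V * (8 / s))" for n
        using fb by (intro AE_I2) (simp add: indicator_def)
      show "AE x in lborel. (\<lambda>n. indicator \<Omega> x *\<^sub>R f n x) \<longlonglongrightarrow> 0"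
      proof (rule AE_I2, rule tendsto_eventually)
        fix x
        show "\<forall>\<^sub>F n in sequentially. indicator \<Omega> x *\<^sub>R f n x = 0"
        proof (cases "x \<in> \<Omega> \<inter> K")
          case True
          then have "r x < 0" using rneg KU by blast
          obtain N where N: "real N > 4 / (- r x)" using reals_Archimedean2 by blast
          have "indicator \<Omega> x *\<^sub>R f n x = 0" if "n \<ge> N" for n
          proof -
            have "4 / (- r x) < real n" using N that by linarith
            then have "4 + real n * r x \<le> 0" using \<open>r x < 0\<close> by (simp add: field_simps)
            then show ?thesis by (simp add: f_def q_def p_def step_eq_0)
          qed
          then show ?thesis by (auto simp: eventually_sequentially)
        next
          case False
          then show ?thesis using z by (intro always_eventually) (auto simp: f_def indicator_def)
        qed
      qed
    qed (use fmeas bint in simp_all)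
    then show ?thesis by (simp add: set_lebesgue_integral_def)
  qed
  have fint: "set_integrable lborel \<Omega> (f n)" for n
    unfolding set_integrable_def
    using fb by (intro Bochner_Integration.integrable_bound[OF bint fmeas] AE_I2) (auto simp: indicator_def intro: order_trans[OF _ abs_ge_self])

  have "boundary_cutoff \<Omega> v (frontier \<Omega> \<inter> ball x0 s) d" if d: "d > 0" for d
  proof -
    \<comment> \<open>Half of the budget \<open>d\<close> goes to the strip, where the cost is at
      most \<open>d' * C\<close>; the other half goes to \<open>f n\<close>. The summand 1 keeps the
      denominator positive if \<open>C\<close> is 0.\<close>
    define d' where "d' = d / (2 * (C + 1))"
    have d': "d' > 0" "d' * C \<le> d / 2" using d C by (auto simp: d'_def field_simps)
    obtain h where h: "h > 0" "\<And>x. x \<in> \<Omega> \<Longrightarrow> x \<in> K \<Longrightarrow> r x > - h \<Longrightarrow> \<bar>v x \<bullet> grad r x\<bar> \<le> d'"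
      using strip[OF d'(1)] by blast
    obtain N where N: "\<And>n. n \<ge> N \<Longrightarrow> (LINT x:\<Omega>|lborel. f n x) < d / 2"
      using order_tendstoD(2)[OF flim, of "d / 2"] d by (auto simp: eventually_sequentially)
    obtain N' where N': "real N' > 4 / h" using reals_Archimedean2 by blast
    \<comment> \<open>Where \<open>k n\<close> is nonzero, \<open>r x > - 4 / n\<close>; making
      \<open>4 / n\<close> smaller than \<open>h\<close> puts these points into the strip with the
      bound \<open>d'\<close>.\<close>
    define n where "n = max N (max 1 N')"
    have n: "n \<ge> N" "real n > 4 / h" "n > 0" using N' by (auto simp: n_def)
    have kd: "k n x * \<bar>v x \<bullet> grad r x\<bar> \<le> d' * k n x" if "x \<in> \<Omega>" for x
    proof (cases "k n x = 0")
      case False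
      then have "x \<in> K" using z by blast
      have "4 + real n * r x > 0" using False step_deriv_eq_0[of "4 + real n * r x"] by (cases "4 + real n * r x \<le> 0") (auto simp: k_def)
      then have "r x > - (4 / real n)" using n(3) by (simp add: field_simps)
      moreover have "4 / real n < h" using n h(1) by (simp add: field_simps)
      ultimately have "\<bar>v x \<bullet> grad r x\<bar> \<le> d'" using h(2)[OF that \<open>x \<in> K\<close>] by simp
      then show ?thesis using mult_right_mono[OF _ k0, of "\<bar>v x \<bullet> grad r x\<bar>" d' n x] by (simp add: mult.commute)
    qed simp
    have le: "q n x + \<bar>v x \<bullet> dq n x\<bar> \<le> f n x + d' * k n x" if "x \<in> \<Omega>" for x
    proof -
      have "\<bar>v x \<bullet> dq n x\<bar> \<le> \<bar>v x \<bullet> p n x\<bar> + \<bar>k n x * (v x \<bullet> grad r x)\<bar>"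
        by (simp add: dq_def inner_add_right)
      then show ?thesis using kd[OF that] k0[of n x] by (simp add: f_def abs_mult)
    qed
    have ki: "set_integrable lborel \<Omega> (k n)"
      unfolding set_integrable_def using kint \<Omega>(1) by (intro integrable_mult_indicator) auto
    have ri: "set_integrable lborel \<Omega> (\<lambda>x. f n x + d' * k n x)"
      using fint ki by (intro set_integral_add) auto
    have li: "set_integrable lborel \<Omega> (\<lambda>x. q n x + \<bar>v x \<bullet> dq n x\<bar>)"
    proof (rule set_integrable_bound[OF ri])
      show "set_borel_measurable lborel \<Omega> (\<lambda>x. q n x + \<bar>v x \<bullet> dq n x\<bar>)"
        unfolding set_borel_measurable_def
        using borel_measurable_continuous_on_indicator[of \<Omega> "\<lambda>x. q n x + \<bar>v x \<bullet> dq n x\<bar>"] \<Omega>(1) vc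
          continuous_on_subset[OF qC] continuous_on_subset[OF dqC]
        by (simp add: continuous_intros)
      show "AE x in lborel. x \<in> \<Omega> \<longrightarrow> norm (q n x + \<bar>v x \<bullet> dq n x\<bar>) \<le> norm (f n x + d' * k n x)"
        using le q01(1)[of n] by (intro AE_I2) (smt (verit) real_norm_def)
    qed
    have "(LINT x:\<Omega>|lborel. q n x + \<bar>v x \<bullet> dq n x\<bar>) \<le> (LINT x:\<Omega>|lborel. f n x + d' * k n x)"
      using li ri le by (rule set_integral_mono)
    also have "\<dots> = (LINT x:\<Omega>|lborel. f n x) + d' * (LINT x:\<Omega>|lborel. k n x)"
      using fint ki by (subst set_integral_add) auto
    also have "(LINT x:\<Omega>|lborel. k n x) \<le> (LINT x|lborel. k n x)"
      unfolding set_lebesgue_integral_def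
      using ki kint k0[of n] by (intro integral_mono) (auto simp: set_integrable_def indicator_def)
    also have "\<dots> \<le> C" by (rule kC_le)
    finally have "(LINT x:\<Omega>|lborel. q n x + \<bar>v x \<bullet> dq n x\<bar>) \<le> (LINT x:\<Omega>|lborel. f n x) + d' * C"
      using d'(1) by simp
    then have fin: "(LINT x:\<Omega>|lborel. q n x + \<bar>v x \<bullet> dq n x\<bar>) \<le> d"
      using N[OF n(1)] d'(2) by linarith
    have sK: "ball x0 s \<subseteq> U" using s KU by (auto simp: K_def)
    have "open (ball x0 s \<inter> r -` {- 2 / real n<..})"
      using continuous_on_subset[OF rc sK] by (intro continuous_open_preimage) auto
    moreover have "frontier \<Omega> \<inter> ball x0 s \<subseteq> ball x0 s \<inter> r -` {- 2 / real n<..}"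
      using rf sK n(3) by auto
    moreover have "q n x = 1" if "x \<in> \<Omega> \<inter> (ball x0 s \<inter> r -` {- 2 / real n<..})" for x
    proof -
      have "4 + real n * r x \<ge> 2" using that n(3) by (simp add: field_simps)
      then show ?thesis using that s by (simp add: q_def step_eq_1 bump_eq_1)
    qed
    ultimately show ?thesis
      unfolding boundary_cutoff_def
      by (intro exI[of _ "q n"] exI[of _ "dq n"] exI[of _ "ball x0 s \<inter> r -` {- 2 / real n<..}"])
        (use q' q01 li fin continuous_on_subset[OF dqC] in auto)
  qed
  with s show ?thesis by blast
qed

text \<open>Half of the cost goes to the finitely many balls around singular points. Since these
  balls are open, the rest of the frontier is compact and consists of regular points only, so
  finitely many neighbourhoods with freely adjustable cost finish the covering.\<close>

lemma boundary_cutoff_frontier: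
  fixes \<Omega> :: "'a::euclidean_space set"
  assumes dom: "bounded_domain \<Omega>"
    and v: "uniformly_continuous_on \<Omega> v"
    and normal: "\<And>x \<nu>. x \<in> frontier \<Omega> \<Longrightarrow> outward_unit_normal \<Omega> x \<nu> \<Longrightarrow>
      ((\<lambda>y. v y \<bullet> \<nu>) \<longlongrightarrow> 0) (at x within \<Omega>)"
    and e: "e > 0"
  shows "boundary_cutoff \<Omega> v (frontier \<Omega>) e"
proof -
  have \<Omega>: "open \<Omega>" "bounded \<Omega>"
    and null: "compact_hypersurface_null {x \<in> frontier \<Omega>. \<nexists>\<nu>. outward_unit_normal \<Omega> x \<nu>}"
    using dom by (auto simp: bounded_domain_def)
  have vc: "continuous_on \<Omega> v" using v by (rule uniformly_continuous_imp_continuous)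
  have "bounded (v ` \<Omega>)" using v \<Omega>(2) by (rule bounded_uniformly_continuous_image)
  then obtain V where V: "V > 0" "\<And>x. x \<in> \<Omega> \<Longrightarrow> norm (v x) \<le> V" by (auto simp: bounded_pos)
  define k where "k = (1 + 8 * V) * 2 ^ DIM('a) * measure lborel (ball (0::'a) 1)"
  have k: "k \<ge> 0" using V by (simp add: k_def)
  \<comment> \<open>The minimum with 1 is there for the radii: each single power of a radius is
    below the sum, hence below 1, which gives the bound \<open>r \<le> 1\<close> required of a ball
    cutoff. In dimension 1 every such power is 1, so \<open>C\<close> is empty.\<close>
  define d where "d = min 1 (e / (2 * (k + 1)))"
  have d: "d > 0" "d \<le> 1" "k * d \<le> e / 2"
  proof -
    show "d > 0" "d \<le> 1" using e k by (auto simp: d_def)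
    have "k * d \<le> k * (e / (2 * (k + 1)))" using k by (intro mult_left_mono) (auto simp: d_def)
    also have "\<dots> \<le> e / 2" using k e by (simp add: field_simps)
    finally show "k * d \<le> e / 2" .
  qed
  obtain C :: "('a \<times> real) set" where C: "finite C" "\<And>c r. (c, r) \<in> C \<Longrightarrow> 0 < r"
    "{x \<in> frontier \<Omega>. \<nexists>\<nu>. outward_unit_normal \<Omega> x \<nu>} \<subseteq> (\<Union>(c, r)\<in>C. ball c r)"
    "(\<Sum>(c, r)\<in>C. r ^ (DIM('a) - 1)) < d"
    using null d(1) unfolding compact_hypersurface_null_def by (metis (no_types, lifting) case_prodD)
  define S where "S = (\<Union>p\<in>C. ball (fst p) (snd p))"
  have "boundary_cutoff \<Omega> v S (\<Sum>p\<in>C. k * snd p ^ (DIM('a) - 1))"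
    unfolding S_def
  proof (rule boundary_cutoff_UN[OF \<Omega>(1) vc C(1)])
    fix p assume p: "p \<in> C"
    have pos: "0 < snd q" if "q \<in> C" for q using C(2)[of "fst q" "snd q"] that by simp
    have "snd p ^ (DIM('a) - 1) \<le> (\<Sum>(c, r)\<in>C. r ^ (DIM('a) - 1))"
      using member_le_sum[of p C "\<lambda>p. snd p ^ (DIM('a) - 1)"] p C(1) pos
      by (simp add: case_prod_beta less_imp_le)
    then have "snd p ^ (DIM('a) - 1) < 1" using C(4) d(2) by linarith
    then have "snd p \<le> 1" using one_le_power[of "snd p" "DIM('a) - 1"] by linarith
    then show "boundary_cutoff \<Omega> v (ball (fst p) (snd p)) (k * snd p ^ (DIM('a) - 1))"
      unfolding k_def using \<Omega> vc V pos[OF p] by (intro boundary_cutoff_ball) auto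
  qed
  moreover have "(\<Sum>p\<in>C. k * snd p ^ (DIM('a) - 1)) \<le> e / 2"
    using C(4) d(3) k mult_left_mono[of "\<Sum>p\<in>C. snd p ^ (DIM('a) - 1)" d k]
    by (simp add: case_prod_beta sum_distrib_left[symmetric])
  ultimately have S: "boundary_cutoff \<Omega> v S (e / 2)" using boundary_cutoff_mono by blast
  define F where "F = frontier \<Omega> - S"
  have "compact F" unfolding F_def S_def
    using \<Omega>(2) by (intro compact_diff compact_frontier_bounded) auto
  have "\<exists>s>0. \<forall>e>0. boundary_cutoff \<Omega> v (frontier \<Omega> \<inter> ball x s) e" if "x \<in> F" for x
  proof -
    have "x \<in> frontier \<Omega>" "x \<notin> S" using that by (auto simp: F_def)
    moreover have "S = (\<Union>(c, r)\<in>C. ball c r)" by (simp add: S_def case_prod_beta)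
    ultimately obtain \<nu> where "outward_unit_normal \<Omega> x \<nu>" using C(3) by blast
    then show ?thesis using \<open>x \<in> frontier \<Omega>\<close> boundary_cutoff_regular[OF \<Omega> v normal] by blast
  qed
  then obtain s where s: "\<And>x. x \<in> F \<Longrightarrow> s x > 0"
    "\<And>x e. x \<in> F \<Longrightarrow> e > 0 \<Longrightarrow> boundary_cutoff \<Omega> v (frontier \<Omega> \<inter> ball x (s x)) e"
    by metis
  obtain D where D: "D \<subseteq> F" "finite D" "F \<subseteq> (\<Union>x\<in>D. ball x (s x))"
    using compactE_image[OF \<open>compact F\<close>, of F "\<lambda>x. ball x (s x)"] s(1) by force
  \<comment> \<open>The remaining half is shared equally; \<open>card D + 1\<close> in place of
    \<open>card D\<close> covers an empty \<open>D\<close>.\<close>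
  have "boundary_cutoff \<Omega> v (\<Union>x\<in>D. frontier \<Omega> \<inter> ball x (s x)) (\<Sum>x\<in>D. e / 2 / (real (card D) + 1))"
    using \<Omega>(1) vc D(2) by (rule boundary_cutoff_UN) (use D(1) s(2) e in auto)
  moreover have "(\<Sum>x\<in>D. e / 2 / (real (card D) + 1)) \<le> e / 2"
    using e by (simp add: field_simps)
  ultimately have "boundary_cutoff \<Omega> v (\<Union>x\<in>D. frontier \<Omega> \<inter> ball x (s x)) (e / 2)"
    using boundary_cutoff_mono by blast
  from boundary_cutoff_Un[OF \<Omega>(1) vc S this] show ?thesis
    by (rule boundary_cutoff_mono) (use D(3) in \<open>auto simp: F_def\<close>)
qed

section \<open>The divergence theorem for tangential fields\<close>

lemma partial_eqI: "(f has_derivative D) (at x) \<Longrightarrow> partial i f x = D i"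
  unfolding partial_def using frechet_derivative_at[of f D x] by simp

lemma Ck_closure_1D:
  assumes "Ck_closure 1 \<Omega> f"
  shows "uniformly_continuous_on \<Omega> f" "f differentiable_on \<Omega>"
    and "i \<in> Basis \<Longrightarrow> uniformly_continuous_on \<Omega> (partial i f)"
  using assms by (simp_all add: One_nat_def)

lemma Ck_closure_1_has_derivative:
  assumes "open \<Omega>" "Ck_closure 1 \<Omega> f" "x \<in> \<Omega>"
  shows "(f has_derivative frechet_derivative f (at x)) (at x)"
proof -
  have "f differentiable (at x)"
    using Ck_closure_1D(2)[OF assms(2)] assms(1,3) by (metis at_within_open differentiable_on_def)
  then show ?thesis by (simp add: frechet_derivative_works)
qed

lemma integral_divg_eq_0:
  fixes \<Omega> :: "'a::euclidean_space set"
  assumes dom: "bounded_domain \<Omega>"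
    and v: "Ck_closure 1 \<Omega> v"
    and normal: "\<And>x \<nu>. x \<in> frontier \<Omega> \<Longrightarrow> outward_unit_normal \<Omega> x \<nu> \<Longrightarrow>
      ((\<lambda>y. v y \<bullet> \<nu>) \<longlongrightarrow> 0) (at x within \<Omega>)"
  shows "(LINT x:\<Omega>|lborel. divg v x) = 0"
proof -
  have \<Omega>: "open \<Omega>" "bounded \<Omega>" using dom by (auto simp: bounded_domain_def)
  note vuc = Ck_closure_1D(1)[OF v]
  have vc: "continuous_on \<Omega> v" using vuc by (rule uniformly_continuous_imp_continuous)
  have pc: "continuous_on \<Omega> (partial i v)" if "i \<in> Basis" for i
    using Ck_closure_1D(3)[OF v that] by (rule uniformly_continuous_imp_continuous)
  have divc: "continuous_on \<Omega> (divg v)"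
    unfolding divg_def[abs_def] using pc by (intro continuous_intros)
  have "uniformly_continuous_on \<Omega> (divg v)"
    unfolding divg_def[abs_def] using Ck_closure_1D(3)[OF v]
    by (intro uniformly_continuous_on_sum bounded_linear.uniformly_continuous_on[OF bounded_linear_inner_left])
  then have divb: "bounded (divg v ` \<Omega>)" using \<Omega>(2) by (rule bounded_uniformly_continuous_image)
  then obtain B where B: "B > 0" "\<And>x. x \<in> \<Omega> \<Longrightarrow> \<bar>divg v x\<bar> \<le> B" by (auto simp: bounded_pos)
  have divi: "set_integrable lborel \<Omega> (divg v)"
    using \<Omega> divc divb by (rule set_integrable_bounded_continuous)
  have bound: "\<bar>LINT x:\<Omega>|lborel. divg v x\<bar> \<le> (B + 1) * e" if e: "e > 0" for e
  proof -
    obtain q dq N where N: "open N" "frontier \<Omega> \<subseteq> N"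
      and q': "\<And>x. x \<in> \<Omega> \<Longrightarrow> (q has_derivative (\<lambda>h. dq x \<bullet> h)) (at x)" and dq: "continuous_on \<Omega> dq"
      and q01: "\<And>x. x \<in> \<Omega> \<Longrightarrow> 0 \<le> q x" "\<And>x. x \<in> \<Omega> \<Longrightarrow> q x \<le> 1"
      and q1: "\<And>x. x \<in> \<Omega> \<Longrightarrow> x \<in> N \<Longrightarrow> q x = 1"
      and qi: "set_integrable lborel \<Omega> (\<lambda>x. q x + \<bar>v x \<bullet> dq x\<bar>)"
      and qe: "(LINT x:\<Omega>|lborel. q x + \<bar>v x \<bullet> dq x\<bar>) \<le> e"
      by (rule boundary_cutoffE[OF boundary_cutoff_frontier[OF dom vuc normal e]], assumption, assumption, rule that)
    have qc: "continuous_on \<Omega> q"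
      using has_derivative_continuous[OF q'] by (intro continuous_at_imp_continuous_on) auto
    \<comment> \<open>The support of \<open>(1 - q) v\<close> in \<Omega>. Since
      \<open>q = 1\<close> near the frontier, the closure does not reach the frontier, and
      \<open>K\<close> is a compact subset of \<Omega>.\<close>
    define K where "K = closure {x \<in> \<Omega>. q x \<noteq> 1}"
    have K: "compact K" unfolding K_def compact_closure
      using \<Omega>(2) by (rule bounded_subset) auto
    have "K \<inter> N = K \<inter> N \<inter> \<Omega>"
    proof -
      have "N \<inter> {x \<in> \<Omega>. q x \<noteq> 1} = {}" using q1 by blast
      then have "N \<inter> K = {}" unfolding K_def using N(1) by (simp add: open_Int_closure_eq_empty)
      then show ?thesis by blast
    qed
    moreover have "K \<subseteq> closure \<Omega>" unfolding K_def by (intro closure_mono) auto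
    moreover have "closure \<Omega> - \<Omega> = frontier \<Omega>" using \<Omega>(1) by (simp add: frontier_def interior_open)
    ultimately have K\<Omega>: "K \<subseteq> \<Omega>" using N(2) by blast
    define f where "f i x = (1 - q x) * (v x \<bullet> i)" for i x
    \<comment> \<open>Gradient of the component \<open>f i\<close> of \<open>(1 - q) v\<close>;
      summing its \<open>i\<close>-th entries over the basis gives the divergence of the truncated
      field.\<close>
    define df where "df i x = (1 - q x) *\<^sub>R grad (\<lambda>y. v y \<bullet> i) x - (v x \<bullet> i) *\<^sub>R dq x" for i x
    have vi: "((\<lambda>y. v y \<bullet> i) has_derivative (\<lambda>h. frechet_derivative v (at x) h \<bullet> i)) (at x)" if "x \<in> \<Omega>" for x i
      using Ck_closure_1_has_derivative[OF \<Omega>(1) v that] by (rule has_derivative_inner_left)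
    then have pvi: "partial j (\<lambda>y. v y \<bullet> i) x = partial j v x \<bullet> i" if "x \<in> \<Omega>" for x i j
      using partial_eqI[OF vi[OF that]] by (simp add: partial_def)
    have f': "(f i has_derivative (\<lambda>h. df i x \<bullet> h)) (at x)" if "x \<in> \<Omega>" for i x
    proof -
      have "((\<lambda>y. v y \<bullet> i) has_derivative (\<lambda>h. grad (\<lambda>y. v y \<bullet> i) x \<bullet> h)) (at x)"
        by (intro has_derivative_grad differentiableI[OF vi[OF that]])
      from has_derivative_mult[OF has_derivative_diff[OF has_derivative_const q'[OF that]] this]
      show ?thesis unfolding f_def[abs_def] df_def
        by (rule has_derivative_eq_rhs) (auto simp: inner_diff_left algebra_simps)
    qed
    have gc: "continuous_on \<Omega> (grad (\<lambda>y. v y \<bullet> i))" for i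
    proof -
      have "continuous_on \<Omega> (\<lambda>x. \<Sum>j\<in>Basis. (partial j v x \<bullet> i) *\<^sub>R j)"
        using pc by (intro continuous_intros)
      then show ?thesis by (rule continuous_on_eq) (simp add: grad_def pvi)
    qed
    have dfc: "continuous_on \<Omega> (df i)" for i
      unfolding df_def[abs_def] using gc qc vc dq by (intro continuous_intros)
    have f0: "f i x = 0" if "x \<in> \<Omega> - K" for i x
      using that closure_subset[of "{x \<in> \<Omega>. q x \<noteq> 1}"] by (auto simp: f_def K_def)
    have df0: "df i x = 0" if "x \<in> \<Omega> - K" for i x
      by (rule gradient_eq_0[OF f', where S="\<Omega> - K"])
        (use that f0 \<Omega>(1) compact_imp_closed[OF K] in auto)
    have zero: "(LINT x:\<Omega>|lborel. df i x \<bullet> i) = 0" for i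
      by (rule set_integral_directional_derivative_eq_0[OF \<Omega>(1) K K\<Omega> f' dfc f0])
    have dfi: "set_integrable lborel \<Omega> (\<lambda>x. df i x \<bullet> i)" for i
      unfolding set_integrable_def
    proof (rule integrable_compact_support[OF K])
      have "continuous_on K (\<lambda>x. df i x \<bullet> i)"
        using continuous_on_subset[OF dfc K\<Omega>] by (intro continuous_intros)
      then show "continuous_on K (\<lambda>x. indicator \<Omega> x *\<^sub>R (df i x \<bullet> i))"
        by (rule continuous_on_eq) (use K\<Omega> in auto)
      show "indicator \<Omega> x *\<^sub>R (df i x \<bullet> i) = 0" if "x \<notin> K" for x
        using that df0 by (auto simp: indicator_def)
    qed
    have sum: "(\<Sum>i\<in>Basis. df i x \<bullet> i) = (1 - q x) * divg v x - v x \<bullet> dq x" if "x \<in> \<Omega>" for x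
    proof -
      have "(\<Sum>i\<in>Basis. df i x \<bullet> i) = (\<Sum>i\<in>Basis. (1 - q x) * (partial i v x \<bullet> i) - (v x \<bullet> i) * (dq x \<bullet> i))"
        by (intro sum.cong) (simp_all add: df_def inner_diff_left grad_def pvi[OF that]
          inner_sum_left_Basis)
      also have "\<dots> = (1 - q x) * divg v x - (\<Sum>i\<in>Basis. (v x \<bullet> i) * (dq x \<bullet> i))"
        by (simp add: sum_subtractf divg_def sum_distrib_left)
      finally show ?thesis by (simp only: euclidean_inner[of "v x" "dq x"])
    qed
    have ind: "(\<lambda>x. indicator \<Omega> x *\<^sub>R (\<Sum>i\<in>Basis. df i x \<bullet> i)) =
        (\<lambda>x. \<Sum>i\<in>Basis. indicator \<Omega> x *\<^sub>R (df i x \<bullet> i))"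
      by (simp only: scaleR_sum_right)
    have "(LINT x:\<Omega>|lborel. \<Sum>i\<in>Basis. df i x \<bullet> i) = (\<Sum>i\<in>Basis. LINT x:\<Omega>|lborel. df i x \<bullet> i)"
      unfolding set_lebesgue_integral_def ind
      using dfi[unfolded set_integrable_def] by (intro Bochner_Integration.integral_sum)
    then have "(LINT x:\<Omega>|lborel. \<Sum>i\<in>Basis. df i x \<bullet> i) = 0"
      by (simp only: zero sum.neutral_const)
    moreover have si: "set_integrable lborel \<Omega> (\<lambda>x. \<Sum>i\<in>Basis. df i x \<bullet> i)"
      unfolding set_integrable_def ind
      using dfi[unfolded set_integrable_def] by (intro Bochner_Integration.integrable_sum)
    ultimately have "(LINT x:\<Omega>|lborel. divg v x) = (LINT x:\<Omega>|lborel. divg v x - (\<Sum>i\<in>Basis. df i x \<bullet> i))"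
      using divi by (subst set_integral_diff) auto
    also have "\<dots> = (LINT x:\<Omega>|lborel. q x * divg v x + v x \<bullet> dq x)"
      by (rule set_lebesgue_integral_cong) (use \<Omega>(1) sum in \<open>auto simp: algebra_simps\<close>)
    finally have eq: "(LINT x:\<Omega>|lborel. divg v x) = (LINT x:\<Omega>|lborel. q x * divg v x + v x \<bullet> dq x)" .
    \<comment> \<open>\<open>B\<close> pays for \<open>q * divg v\<close>, and the additional 1 pays
      for \<open>v . dq\<close> in full.\<close>
    have le: "\<bar>q x * divg v x + v x \<bullet> dq x\<bar> \<le> (B + 1) * (q x + \<bar>v x \<bullet> dq x\<bar>)" if "x \<in> \<Omega>" for x
    proof -
      have "\<bar>q x * divg v x\<bar> \<le> B * q x"
        using mult_left_mono[OF B(2)[OF that] q01(1)[OF that]] q01(1)[OF that] by (simp add: abs_mult mult.commute)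
      moreover have "0 \<le> B * \<bar>v x \<bullet> dq x\<bar>" using B(1) by simp
      ultimately show ?thesis using q01(1)[OF that] by (simp add: algebra_simps)
    qed
    have "set_integrable lborel \<Omega> (\<lambda>x. divg v x - (\<Sum>i\<in>Basis. df i x \<bullet> i))"
      using divi si by (rule set_integral_diff)
    moreover have "set_integrable lborel \<Omega> (\<lambda>x. divg v x - (\<Sum>i\<in>Basis. df i x \<bullet> i)) =
        set_integrable lborel \<Omega> (\<lambda>x. q x * divg v x + v x \<bullet> dq x)"
      by (rule set_integrable_cong) (use sum in \<open>auto simp: algebra_simps\<close>)
    ultimately have li: "set_integrable lborel \<Omega> (\<lambda>x. q x * divg v x + v x \<bullet> dq x)" by simp
    have ri: "set_integrable lborel \<Omega> (\<lambda>x. (B + 1) * (q x + \<bar>v x \<bullet> dq x\<bar>))" using qi by simp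
    have "norm (LINT x:\<Omega>|lborel. q x * divg v x + v x \<bullet> dq x) \<le> (LINT x:\<Omega>|lborel. (B + 1) * (q x + \<bar>v x \<bullet> dq x\<bar>))"
      unfolding set_lebesgue_integral_def
      by (rule Bochner_Integration.integral_norm_bound_integral)
        (use li ri le in \<open>auto simp: set_integrable_def indicator_def\<close>)
    also have "\<dots> \<le> (B + 1) * e" using qe B(1) by (simp add: mult_left_mono)
    finally show ?thesis using eq by simp
  qed
  have "\<bar>LINT x:\<Omega>|lborel. divg v x\<bar> \<le> 0 + e" if "e > 0" for e
    using bound[of "e / (B + 1)"] that B(1) by simp
  then have "\<bar>LINT x:\<Omega>|lborel. divg v x\<bar> \<le> 0" by (rule field_le_epsilon)
  then show ?thesis by simp
qed

section \<open>Functions with derivatives continuous up to the boundary\<close>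

text \<open>\<open>frechet_derivative\<close> chooses among all derivatives, and functions equal
  near \<open>x\<close> admit the same ones. The choices therefore agree even at points where
  neither function is differentiable.\<close>

lemma frechet_derivative_cong_open:
  assumes "open S" "x \<in> S" "\<And>y. y \<in> S \<Longrightarrow> f y = g y"
  shows "frechet_derivative f (at x) = frechet_derivative g (at x)"
proof -
  have "(f has_derivative D) (at x) \<longleftrightarrow> (g has_derivative D) (at x)" for D
    using has_derivative_transform_within_open[OF _ assms(1,2)] assms(3) by metis
  then show ?thesis unfolding frechet_derivative_def by simp
qed

lemma partial_cong_open:
  assumes "open S" "x \<in> S" "\<And>y. y \<in> S \<Longrightarrow> f y = g y"
  shows "partial i f x = partial i g x"
  unfolding partial_def using frechet_derivative_cong_open[OF assms] by simp

lemma divg_cong_open: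
  assumes "open S" "x \<in> S" "\<And>y. y \<in> S \<Longrightarrow> f y = g y"
  shows "divg f x = divg g x"
  unfolding divg_def using partial_cong_open[OF assms] by simp

lemma partial_bounded_linear:
  assumes "bounded_linear L" "f differentiable (at x)"
  shows "partial i (\<lambda>y. L (f y)) x = L (partial i f x)"
  using partial_eqI[OF bounded_linear.has_derivative[OF assms(1) frechet_derivative_works[THEN iffD1, OF assms(2)]], of i]
  by (simp only: partial_def)

lemma partial_add:
  assumes "f differentiable (at x)" "g differentiable (at x)"
  shows "partial i (\<lambda>y. f y + g y) x = partial i f x + partial i g x"
  using partial_eqI[OF has_derivative_add[OF frechet_derivative_works[THEN iffD1, OF assms(1)]
      frechet_derivative_works[THEN iffD1, OF assms(2)]], of i]
  by (simp only: partial_def)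

lemma (in bounded_bilinear) partial_prod:
  fixes f :: "'e::euclidean_space \<Rightarrow> 'a"
  assumes "f differentiable (at x)" "g differentiable (at x)"
  shows "partial i (\<lambda>y. prod (f y) (g y)) x = prod (f x) (partial i g x) + prod (partial i f x) (g x)"
  using partial_eqI[OF FDERIV[OF frechet_derivative_works[THEN iffD1, OF assms(1)]
      frechet_derivative_works[THEN iffD1, OF assms(2)]], of i]
  by (simp only: partial_def)

lemma divg_add:
  assumes "f differentiable (at x)" "g differentiable (at x)"
  shows "divg (\<lambda>y. f y + g y) x = divg f x + divg g x"
  by (simp add: divg_def partial_add[OF assms] inner_add_left sum.distrib)

lemma divg_scaleR_const:
  assumes "f differentiable (at x)"
  shows "divg (\<lambda>y. c *\<^sub>R f y) x = c * divg f x"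
  by (simp add: divg_def partial_bounded_linear[OF bounded_linear_scaleR_right assms] sum_distrib_left)

lemma inner_grad: "grad f x \<bullet> w = (\<Sum>i\<in>Basis. partial i f x * (w \<bullet> i))"
  unfolding grad_def inner_sum_left by (intro sum.cong) (simp_all add: inner_commute)

lemma divg_scaleR:
  assumes "f differentiable (at x)" "w differentiable (at x)"
  shows "divg (\<lambda>y. f y *\<^sub>R w y) x = f x * divg w x + grad f x \<bullet> w x"
  by (simp add: divg_def bounded_bilinear.partial_prod[OF bounded_bilinear_scaleR assms]
      inner_add_left sum.distrib sum_distrib_left inner_grad)

lemma uniformly_continuous_on_cong_on:
  fixes f :: "'a::metric_space \<Rightarrow> 'b::metric_space"
  assumes "uniformly_continuous_on S f" "\<And>x. x \<in> S \<Longrightarrow> f x = g x"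
  shows "uniformly_continuous_on S g"
  using assms(1) by (simp add: uniformly_continuous_on_def assms(2) cong: ball_cong)

text \<open>Products of uniformly continuous functions need not be uniformly continuous on unbounded
  sets. On a bounded set both factors extend continuously to the compact closure, completeness of
  the target spaces providing the extension, and there continuity suffices.\<close>

lemma uniformly_continuous_on_bilinear:
  fixes f :: "'e::euclidean_space \<Rightarrow> 'a::banach" and g :: "'e \<Rightarrow> 'b::banach"
  assumes "bounded_bilinear prd" "bounded S" "uniformly_continuous_on S f" "uniformly_continuous_on S g"
  shows "uniformly_continuous_on S (\<lambda>x. prd (f x) (g x))"
proof -
  obtain f' where f': "uniformly_continuous_on (closure S) f'" "\<And>x. x \<in> S \<Longrightarrow> f x = f' x"
    by (rule uniformly_continuous_on_extension_on_closure[OF assms(3)], rule that)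
  obtain g' where g': "uniformly_continuous_on (closure S) g'" "\<And>x. x \<in> S \<Longrightarrow> g x = g' x"
    by (rule uniformly_continuous_on_extension_on_closure[OF assms(4)], rule that)
  have "continuous_on (closure S) (\<lambda>x. prd (f' x) (g' x))"
    using f'(1) g'(1) by (intro bounded_bilinear.continuous_on[OF assms(1)] uniformly_continuous_imp_continuous)
  then have "uniformly_continuous_on (closure S) (\<lambda>x. prd (f' x) (g' x))"
    using assms(2) by (intro compact_uniformly_continuous) (auto simp: compact_closure)
  then have "uniformly_continuous_on S (\<lambda>x. prd (f' x) (g' x))"
    using subsetD[OF closure_subset, of _ S] by (simp add: uniformly_continuous_on_def) meson
  then show ?thesis by (rule uniformly_continuous_on_cong_on) (use f' g' in auto)
qed

text \<open>Sum and product rules for \<open>partial\<close> hold only at points of \<Omega>, as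
  functions are arbitrary elsewhere. This lemma lets such local identities replace equality of
  functions in the inductions on the order.\<close>

lemma Ck_closure_cong:
  assumes "open \<Omega>" "Ck_closure k \<Omega> f" "\<And>x. x \<in> \<Omega> \<Longrightarrow> f x = g x"
  shows "Ck_closure k \<Omega> g"
  using assms(2,3)
proof (induction k arbitrary: f g)
  case 0
  then show ?case by (auto intro: uniformly_continuous_on_cong_on)
next
  case (Suc k)
  have "uniformly_continuous_on \<Omega> g"
    using Suc.prems by (auto intro: uniformly_continuous_on_cong_on)
  moreover have "g differentiable_on \<Omega>"
    using Suc.prems by (auto simp: differentiable_on_def intro: differentiable_transform_within[OF _ zero_less_one])
  moreover have "Ck_closure k \<Omega> (partial i g)" if "i \<in> Basis" for i
  proof (rule Suc.IH)
    show "Ck_closure k \<Omega> (partial i f)" using Suc.prems(1) that by simp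
    show "partial i f x = partial i g x" if "x \<in> \<Omega>" for x
      using assms(1) that Suc.prems(2) by (rule partial_cong_open)
  qed
  ultimately show ?case by simp
qed

lemma Ck_closure_differentiable:
  assumes "open \<Omega>" "Ck_closure (Suc k) \<Omega> f" "x \<in> \<Omega>"
  shows "f differentiable (at x)"
proof -
  have "f differentiable_on \<Omega>" using assms(2) by simp
  then have "f differentiable (at x within \<Omega>)" using assms(3) unfolding differentiable_on_def by blast
  then show ?thesis using at_within_open[OF assms(3,1)] by simp
qed

lemma Ck_closure_bounded_linear:
  assumes "open \<Omega>" "bounded_linear L" "Ck_closure k \<Omega> f"
  shows "Ck_closure k \<Omega> (\<lambda>x. L (f x))"
  using assms(3)
proof (induction k arbitrary: f)
  case 0
  then have "uniformly_continuous_on \<Omega> f" by simp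
  then have "uniformly_continuous_on \<Omega> (\<lambda>x. L (f x))"
    by (rule bounded_linear.uniformly_continuous_on[OF assms(2)])
  then show ?case by simp
next
  case (Suc k)
  have "(\<lambda>x. L (f x)) differentiable (at x)" if "x \<in> \<Omega>" for x
    using bounded_linear.has_derivative[OF assms(2)
        frechet_derivative_works[THEN iffD1, OF Ck_closure_differentiable[OF assms(1) Suc.prems that]]]
    by (rule differentiableI)
  then have "(\<lambda>x. L (f x)) differentiable_on \<Omega>"
    by (simp add: differentiable_on_def differentiable_at_withinI)
  moreover have "Ck_closure k \<Omega> (partial i (\<lambda>x. L (f x)))" if "i \<in> Basis" for i
  proof (rule Ck_closure_cong[OF assms(1) Suc.IH])
    show "Ck_closure k \<Omega> (partial i f)" using Suc.prems that by simp
    show "L (partial i f x) = partial i (\<lambda>x. L (f x)) x" if "x \<in> \<Omega>" for x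
      using partial_bounded_linear[OF assms(2) Ck_closure_differentiable[OF assms(1) Suc.prems that]] by simp
  qed
  moreover have "uniformly_continuous_on \<Omega> (\<lambda>x. L (f x))"
    using Suc.prems by (intro bounded_linear.uniformly_continuous_on[OF assms(2)]) auto
  ultimately show ?case unfolding Ck_closure.simps by blast
qed

lemma Ck_closure_add:
  assumes "open \<Omega>" "Ck_closure k \<Omega> f" "Ck_closure k \<Omega> g"
  shows "Ck_closure k \<Omega> (\<lambda>x. f x + g x)"
  using assms(2,3)
proof (induction k arbitrary: f g)
  case 0
  then have "uniformly_continuous_on \<Omega> f" "uniformly_continuous_on \<Omega> g" by auto
  then have "uniformly_continuous_on \<Omega> (\<lambda>x. f x + g x)" by (rule uniformly_continuous_on_add)
  then show ?case by simp
next
  case (Suc k)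
  have "(\<lambda>x. f x + g x) differentiable_on \<Omega>"
    using Suc.prems by (intro differentiable_on_add) simp_all
  moreover have "Ck_closure k \<Omega> (partial i (\<lambda>x. f x + g x))" if "i \<in> Basis" for i
  proof (rule Ck_closure_cong[OF assms(1) Suc.IH])
    show "Ck_closure k \<Omega> (partial i f)" "Ck_closure k \<Omega> (partial i g)" using Suc.prems that by simp_all
    show "partial i f x + partial i g x = partial i (\<lambda>x. f x + g x) x" if "x \<in> \<Omega>" for x
      using partial_add[OF Ck_closure_differentiable[OF assms(1) Suc.prems(1) that]
          Ck_closure_differentiable[OF assms(1) Suc.prems(2) that]] by simp
  qed
  moreover have "uniformly_continuous_on \<Omega> (\<lambda>x. f x + g x)"
    using Suc.prems by (intro uniformly_continuous_on_add) auto
  ultimately show ?case unfolding Ck_closure.simps by blast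
qed

text \<open>Order 1 is what the divergence theorem asks of a flux, and all products below occur
  inside fluxes or integrands. A general bilinear product serves \<open>*\<close>, the inner product
  and \<open>scaleR\<close> at once.\<close>

lemma Ck_closure_1_prod:
  fixes f :: "'e::euclidean_space \<Rightarrow> 'a::banach" and g :: "'e \<Rightarrow> 'b::banach"
  assumes "bounded_bilinear prd" "open \<Omega>" "bounded \<Omega>" "Ck_closure 1 \<Omega> f" "Ck_closure 1 \<Omega> g"
  shows "Ck_closure 1 \<Omega> (\<lambda>x. prd (f x) (g x))"
proof -
  note uc = uniformly_continuous_on_bilinear[OF assms(1,3)]
  note f = Ck_closure_1D[OF assms(4)] and g = Ck_closure_1D[OF assms(5)]
  note fd = Ck_closure_differentiable[OF assms(2) assms(4)[unfolded One_nat_def]]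
  note gd = Ck_closure_differentiable[OF assms(2) assms(5)[unfolded One_nat_def]]
  have "(\<lambda>x. prd (f x) (g x)) differentiable (at x)" if "x \<in> \<Omega>" for x
    using bounded_bilinear.FDERIV[OF assms(1)
        frechet_derivative_works[THEN iffD1, OF fd[OF that]] frechet_derivative_works[THEN iffD1, OF gd[OF that]]]
    by (rule differentiableI)
  then have "(\<lambda>x. prd (f x) (g x)) differentiable_on \<Omega>"
    by (simp add: differentiable_on_def differentiable_at_withinI)
  moreover have "uniformly_continuous_on \<Omega> (partial i (\<lambda>x. prd (f x) (g x)))" if "i \<in> Basis" for i
  proof (rule uniformly_continuous_on_cong_on)
    show "uniformly_continuous_on \<Omega> (\<lambda>x. prd (f x) (partial i g x) + prd (partial i f x) (g x))"
      using f g that by (intro uniformly_continuous_on_add uc)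
    show "prd (f x) (partial i g x) + prd (partial i f x) (g x) = partial i (\<lambda>x. prd (f x) (g x)) x" if "x \<in> \<Omega>" for x
      using bounded_bilinear.partial_prod[OF assms(1) fd[OF that] gd[OF that]] by simp
  qed
  moreover have "uniformly_continuous_on \<Omega> (\<lambda>x. prd (f x) (g x))"
    using f(1) g(1) by (rule uc)
  ultimately show ?thesis unfolding One_nat_def Ck_closure.simps by blast
qed

lemma Ck_closure_zero: "Ck_closure k \<Omega> (\<lambda>x::'a::euclidean_space. 0::'b::real_normed_vector)"
proof -
  have "partial i (\<lambda>x::'a. 0::'b) = (\<lambda>x. 0)" for i
    using partial_eqI[OF has_derivative_const] by (rule ext)
  then show ?thesis by (induction k) (auto simp: uniformly_continuous_on_const)
qed

lemma Ck_closure_sum: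
  assumes "open \<Omega>" "\<And>i. i \<in> I \<Longrightarrow> Ck_closure k \<Omega> (f i)"
  shows "Ck_closure k \<Omega> (\<lambda>x. \<Sum>i\<in>I. f i x)"
  using assms(2)
proof (induction I rule: infinite_finite_induct)
  case (insert i I)
  then have "Ck_closure k \<Omega> (\<lambda>x. f i x + (\<Sum>i\<in>I. f i x))"
    by (intro Ck_closure_add[OF assms(1)]) auto
  with insert.hyps show ?case by simp
qed (simp_all add: Ck_closure_zero)

lemma Ck_closure_2D:
  assumes "Ck_closure 2 \<Omega> f"
  shows "Ck_closure 1 \<Omega> f" "i \<in> Basis \<Longrightarrow> Ck_closure 1 \<Omega> (partial i f)"
  using assms by (simp_all add: numeral_2_eq_2)

lemma Ck_closure_grad:
  assumes "open \<Omega>" "Ck_closure 2 \<Omega> f"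
  shows "Ck_closure 1 \<Omega> (grad f)"
  unfolding grad_def[abs_def]
  using Ck_closure_2D(2)[OF assms(2)]
  by (intro Ck_closure_sum[OF assms(1)] Ck_closure_bounded_linear[OF assms(1) bounded_linear_scaleR_left])

lemma lapl_eq_divg_grad:
  assumes "open \<Omega>" "Ck_closure 2 \<Omega> f" "x \<in> \<Omega>"
  shows "lapl f x = divg (grad f) x"
proof -
  have d: "partial i f differentiable (at x)" if "i \<in> Basis" for i
    using Ck_closure_2D(2)[OF assms(2) that] assms by (simp add: Ck_closure_differentiable[where k=0])
  have "((\<lambda>y. \<Sum>i\<in>Basis. partial i f y *\<^sub>R i) has_derivative
      (\<lambda>h. \<Sum>i\<in>Basis. frechet_derivative (partial i f) (at x) h *\<^sub>R i)) (at x)"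
    using frechet_derivative_works[THEN iffD1, OF d] by (intro has_derivative_sum has_derivative_scaleR_left)
  then have "partial j (grad f) x = (\<Sum>i\<in>Basis. partial j (partial i f) x *\<^sub>R i)" for j
    using partial_eqI[of "grad f" _ x j] unfolding grad_def[abs_def] by (simp add: partial_def[of j "partial _ f"])
  then show ?thesis
    by (simp add: lapl_def divg_def inner_sum_left inner_Basis if_distrib sum.delta cong: if_cong)
qed

lemma set_integrable_uniformly_continuous:
  fixes f :: "'a::euclidean_space \<Rightarrow> 'b::euclidean_space"
  assumes "open \<Omega>" "bounded \<Omega>" "uniformly_continuous_on \<Omega> f"
  shows "set_integrable lborel \<Omega> f"
  using assms uniformly_continuous_imp_continuous bounded_uniformly_continuous_image
  by (intro set_integrable_bounded_continuous)

section \<open>Energy balance of the splitting steps\<close>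

text \<open>The common consequence of the no-slip condition on a velocity and of the Neumann
  condition on a potential. It is stable under sums and bounded scalar factors, so the boundary
  behaviour of a composite flux can be checked term by term.\<close>

definition tangential :: "'a::euclidean_space set \<Rightarrow> ('a \<Rightarrow> 'a) \<Rightarrow> bool" where
  "tangential \<Omega> v \<longleftrightarrow> (\<forall>x\<in>frontier \<Omega>. \<forall>\<nu>. outward_unit_normal \<Omega> x \<nu> \<longrightarrow>
      ((\<lambda>y. v y \<bullet> \<nu>) \<longlongrightarrow> 0) (at x within \<Omega>))"

lemma tangential_grad: "tangential \<Omega> (grad f) \<longleftrightarrow> zero_normal_derivative \<Omega> f"
  by (simp add: tangential_def zero_normal_derivative_def)

lemma tangential_zero_on_boundary: "zero_on_boundary \<Omega> v \<Longrightarrow> tangential \<Omega> v"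
  unfolding tangential_def zero_on_boundary_def using tendsto_inner[OF _ tendsto_const] by fastforce

lemma tangential_add: "tangential \<Omega> v \<Longrightarrow> tangential \<Omega> w \<Longrightarrow> tangential \<Omega> (\<lambda>x. v x + w x)"
  unfolding tangential_def inner_add_left using tendsto_add_zero by blast

lemma tendsto_zero_bounded_mult:
  fixes f g :: "'a::euclidean_space \<Rightarrow> real"
  assumes "bounded (f ` S)" "(g \<longlongrightarrow> 0) (at x within S)"
  shows "((\<lambda>y. f y * g y) \<longlongrightarrow> 0) (at x within S)"
proof -
  obtain B where B: "\<And>y. y \<in> S \<Longrightarrow> \<bar>f y\<bar> \<le> B" using assms(1) by (auto simp: bounded_iff)
  have "\<forall>\<^sub>F y in at x within S. norm (f y * g y) \<le> norm (g y) * B"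
    unfolding eventually_at_filter
    by (rule always_eventually) (auto simp: abs_mult mult.commute intro!: mult_right_mono B)
  then show ?thesis using assms(2) by (rule tendsto_0_le[rotated])
qed

lemma tangential_scaleR:
  assumes "bounded (f ` \<Omega>)" "tangential \<Omega> v"
  shows "tangential \<Omega> (\<lambda>x. f x *\<^sub>R v x)"
  using assms(2) tendsto_zero_bounded_mult[OF assms(1)] unfolding tangential_def by simp

lemma tangential_scaleR_const: "tangential \<Omega> v \<Longrightarrow> tangential \<Omega> (\<lambda>x. c *\<^sub>R v x)"
  by (rule tangential_scaleR) (auto intro: finite_imp_bounded simp: image_constant_conv)

lemma zero_on_boundary_avg:
  "zero_on_boundary \<Omega> u \<Longrightarrow> zero_on_boundary \<Omega> v \<Longrightarrow> zero_on_boundary \<Omega> (avg u v)"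
  unfolding zero_on_boundary_def avg_def[abs_def]
  using tendsto_scaleR[OF tendsto_const tendsto_add_zero] by fastforce

lemma zero_on_boundary_inner:
  assumes "bounded (f ` \<Omega>)" "zero_on_boundary \<Omega> u"
  shows "zero_on_boundary \<Omega> (\<lambda>x. f x \<bullet> u x)"
  unfolding zero_on_boundary_def
proof
  fix x assume "x \<in> frontier \<Omega>"
  then have u: "(u \<longlongrightarrow> 0) (at x within \<Omega>)" using assms(2) by (auto simp: zero_on_boundary_def)
  obtain B where B: "\<And>y. y \<in> \<Omega> \<Longrightarrow> norm (f y) \<le> B" using assms(1) by (auto simp: bounded_iff)
  have "\<forall>\<^sub>F y in at x within \<Omega>. norm (f y \<bullet> u y) \<le> norm (u y) * B"
    unfolding eventually_at_filter
  proof (rule always_eventually, intro allI impI)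
    fix y assume "y \<in> \<Omega>"
    then show "norm (f y \<bullet> u y) \<le> norm (u y) * B"
      using Cauchy_Schwarz_ineq2[of "f y" "u y"] mult_right_mono[OF B norm_ge_zero, of y "u y"]
      by (simp add: mult.commute)
  qed
  with u show "((\<lambda>x. f x \<bullet> u x) \<longlongrightarrow> 0) (at x within \<Omega>)" by (rule tendsto_0_le)
qed

lemma zero_on_boundary_scaleR_left:
  assumes "bounded (w ` \<Omega>)" "zero_on_boundary \<Omega> f"
  shows "zero_on_boundary \<Omega> (\<lambda>x. f x *\<^sub>R w x)"
  unfolding zero_on_boundary_def
proof
  fix x assume "x \<in> frontier \<Omega>"
  then have f: "(f \<longlongrightarrow> 0) (at x within \<Omega>)" using assms(2) by (auto simp: zero_on_boundary_def)
  obtain B where B: "\<And>y. y \<in> \<Omega> \<Longrightarrow> norm (w y) \<le> B" using assms(1) by (auto simp: bounded_iff)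
  have "\<forall>\<^sub>F y in at x within \<Omega>. norm (f y *\<^sub>R w y) \<le> norm (f y) * B"
    unfolding eventually_at_filter
    by (rule always_eventually) (auto intro!: mult_left_mono B)
  with f show "((\<lambda>x. f x *\<^sub>R w x) \<longlongrightarrow> 0) (at x within \<Omega>)" by (rule tendsto_0_le)
qed

lemma zero_on_boundary_sum_scaleR_Basis:
  assumes "\<And>i. i \<in> Basis \<Longrightarrow> zero_on_boundary \<Omega> (f i)"
  shows "zero_on_boundary \<Omega> (\<lambda>x. \<Sum>i\<in>Basis. f i x *\<^sub>R i)"
  using assms unfolding zero_on_boundary_def
  by (auto intro!: tendsto_null_sum tendsto_eq_intros)

lemma Ck_closure_scaleR_const:
  "open \<Omega> \<Longrightarrow> Ck_closure k \<Omega> f \<Longrightarrow> Ck_closure k \<Omega> (\<lambda>x. c *\<^sub>R f x)"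
  by (rule Ck_closure_bounded_linear[OF _ bounded_linear_scaleR_right])

lemma Ck_closure_avg:
  assumes "open \<Omega>" "Ck_closure k \<Omega> f" "Ck_closure k \<Omega> g"
  shows "Ck_closure k \<Omega> (avg f g)"
  unfolding avg_def[abs_def] by (intro Ck_closure_scaleR_const Ck_closure_add assms)

lemma Ck_closure_extrap:
  assumes "open \<Omega>" "Ck_closure k \<Omega> f" "Ck_closure k \<Omega> g"
  shows "Ck_closure k \<Omega> (extrap s f g)"
proof -
  have "extrap s f g = (\<lambda>x. (1 + s) *\<^sub>R f x + (- s) *\<^sub>R g x)" by (simp add: extrap_def fun_eq_iff)
  then show ?thesis using assms by (simp only:) (intro Ck_closure_scaleR_const Ck_closure_add)
qed

lemma Ck_closure_1_bounded:
  fixes f :: "'a::euclidean_space \<Rightarrow> 'b::euclidean_space"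
  shows "bounded \<Omega> \<Longrightarrow> Ck_closure 1 \<Omega> f \<Longrightarrow> bounded (f ` \<Omega>)"
  by (rule bounded_uniformly_continuous_image[OF Ck_closure_1D(1)])

lemma Ck_closure_1_differentiable:
  "open \<Omega> \<Longrightarrow> Ck_closure 1 \<Omega> f \<Longrightarrow> x \<in> \<Omega> \<Longrightarrow> f differentiable (at x)"
  unfolding One_nat_def by (rule Ck_closure_differentiable)

text \<open>Both halves of the convection form, tested with \<open>u\<close>, contain half of
  \<open>v . grad (u . u)\<close>, and the second one also contains \<open>divg v * (u . u)\<close>.
  Their mean is therefore an exact divergence: convection only transports kinetic energy.\<close>

lemma convB_inner:
  assumes v: "v differentiable (at x)" and u: "u differentiable (at x)"
  shows "convB v u x \<bullet> u x = (1/2) * divg (\<lambda>y. (u y \<bullet> u y) *\<^sub>R v y) x"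
proof -
  have ui: "(\<lambda>y. u y \<bullet> i) differentiable (at x)" for i
    using u by (rule differentiable_inner) simp
  have pui: "partial j (\<lambda>y. u y \<bullet> i) x = partial j u x \<bullet> i" for i j
    using partial_bounded_linear[OF bounded_linear_inner_left u] .
  have uu: "(\<lambda>y. u y \<bullet> u y) differentiable (at x)"
    using u u by (rule differentiable_inner)
  have puu: "partial j (\<lambda>y. u y \<bullet> u y) x = 2 * (partial j u x \<bullet> u x)" for j
    using bounded_bilinear.partial_prod[OF bounded_bilinear_inner u u] by (simp add: inner_commute)
  define A where "A = (\<Sum>j\<in>Basis. (v x \<bullet> j) * (partial j u x \<bullet> u x))"
  have dui: "divg (\<lambda>y. (u y \<bullet> i) *\<^sub>R v y) x
      = (u x \<bullet> i) * divg v x + (\<Sum>j\<in>Basis. (partial j u x \<bullet> i) * (v x \<bullet> j))" for i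
    unfolding divg_scaleR[OF ui v] inner_grad pui ..
  have "(\<Sum>i\<in>Basis. divg (\<lambda>y. (u y \<bullet> i) *\<^sub>R v y) x *\<^sub>R i) \<bullet> u x
      = (\<Sum>i\<in>Basis. ((u x \<bullet> i) * divg v x + (\<Sum>j\<in>Basis. (partial j u x \<bullet> i) * (v x \<bullet> j))) * (u x \<bullet> i))"
    unfolding inner_sum_left dui inner_scaleR_left by (simp only: inner_commute[of _ "u x"])
  also have "\<dots> = divg v x * (\<Sum>i\<in>Basis. (u x \<bullet> i) * (u x \<bullet> i))
      + (\<Sum>i\<in>Basis. \<Sum>j\<in>Basis. (v x \<bullet> j) * ((partial j u x \<bullet> i) * (u x \<bullet> i)))"
    by (simp add: distrib_left distrib_right sum.distrib sum_distrib_left sum_distrib_right mult_ac)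
  \<comment> \<open>With the sum over components innermost, \<open>partial j u x . u x\<close> can
    be reassembled from its coordinates.\<close>
  also have "(\<Sum>i\<in>Basis. \<Sum>j\<in>Basis. (v x \<bullet> j) * ((partial j u x \<bullet> i) * (u x \<bullet> i)))
      = (\<Sum>j\<in>Basis. (v x \<bullet> j) * (\<Sum>i\<in>Basis. (partial j u x \<bullet> i) * (u x \<bullet> i)))"
    unfolding sum_distrib_left by (rule sum.swap)
  also have "\<dots> = A"
    unfolding A_def by (simp only: euclidean_inner[of "partial _ u x" "u x"])
  also have "(\<Sum>i\<in>Basis. (u x \<bullet> i) * (u x \<bullet> i)) = u x \<bullet> u x"
    by (simp only: euclidean_inner[of "u x" "u x"])
  finally have 1: "(\<Sum>i\<in>Basis. divg (\<lambda>y. (u y \<bullet> i) *\<^sub>R v y) x *\<^sub>R i) \<bullet> u x = divg v x * (u x \<bullet> u x) + A" .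
  have 2: "(\<Sum>i\<in>Basis. (v x \<bullet> i) *\<^sub>R partial i u x) \<bullet> u x = A"
    by (simp add: A_def inner_sum_left)
  have 3: "divg (\<lambda>y. (u y \<bullet> u y) *\<^sub>R v y) x = divg v x * (u x \<bullet> u x) + 2 * A"
    unfolding divg_scaleR[OF uu v] inner_grad puu A_def
    by (simp add: sum_distrib_left mult_ac)
  show ?thesis unfolding convB_def inner_scaleR_left inner_add_left 1 2 3 by simp
qed

text \<open>The field is the gradient of half of \<open>u . u\<close>, so this is the pointwise form
  of Green's first identity for a vector field.\<close>

lemma divg_partial_inner:
  assumes u: "u differentiable (at x)" and d: "\<And>i. i \<in> Basis \<Longrightarrow> partial i u differentiable (at x)"
  shows "divg (\<lambda>y. \<Sum>i\<in>Basis. (partial i u y \<bullet> u y) *\<^sub>R i) x = lapl u x \<bullet> u x + (grad_abs u x)\<^sup>2"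
proof -
  have "(\<lambda>y. partial i u y \<bullet> u y) differentiable (at x)" if "i \<in> Basis" for i
    using d[OF that] u by (rule differentiable_inner)
  then have D: "((\<lambda>y. \<Sum>i\<in>Basis. (partial i u y \<bullet> u y) *\<^sub>R i) has_derivative
      (\<lambda>h. \<Sum>i\<in>Basis. frechet_derivative (\<lambda>y. partial i u y \<bullet> u y) (at x) h *\<^sub>R i)) (at x)"
    by (intro has_derivative_sum has_derivative_scaleR_left) (simp add: frechet_derivative_works)
  have "divg (\<lambda>y. \<Sum>i\<in>Basis. (partial i u y \<bullet> u y) *\<^sub>R i) x = (\<Sum>j\<in>Basis. partial j (\<lambda>y. partial j u y \<bullet> u y) x)"
    unfolding divg_def partial_eqI[OF D]
    by (intro sum.cong refl) (simp add: partial_def[of _ "\<lambda>y. partial _ u y \<bullet> u y"])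
  also have "\<dots> = (\<Sum>j\<in>Basis. partial j (partial j u) x \<bullet> u x + (norm (partial j u x))\<^sup>2)"
    using bounded_bilinear.partial_prod[OF bounded_bilinear_inner d u]
    by (intro sum.cong refl) (simp add: power2_norm_eq_inner)
  finally show ?thesis
    by (simp add: lapl_def grad_abs_def sum.distrib inner_sum_left sum_nonneg)
qed

section \<open>The kinetic energy law of the two Navier-Stokes half steps\<close>

lemma integral_divg_tangential:
  assumes "bounded_domain \<Omega>" "Ck_closure 1 \<Omega> v" "tangential \<Omega> v"
  shows "(LINT x:\<Omega>|lborel. divg v x) = 0"
  using assms(3) unfolding tangential_def by (intro integral_divg_eq_0[OF assms(1,2)]) blast

lemma uniformly_continuous_on_divg:
  assumes "Ck_closure 1 \<Omega> v"
  shows "uniformly_continuous_on \<Omega> (divg v)"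
  unfolding divg_def[abs_def] using Ck_closure_1D(3)[OF assms]
  by (intro uniformly_continuous_on_sum bounded_linear.uniformly_continuous_on[OF bounded_linear_inner_left])

lemma power2_L2_norm: "(L2_norm \<Omega> g)\<^sup>2 = (LINT x:\<Omega>|lborel. (norm (g x))\<^sup>2)"
  unfolding L2_norm_def by (subst real_sqrt_pow2) (auto intro!: integral_nonneg simp: set_lebesgue_integral_def)

text \<open>Testing with the mean \<open>w\<close> makes the time difference exact:
  \<open>(u1 - u0) . w\<close> is half the difference of the squared norms. Pressure and convection
  act through divergences only, the pressure because \<open>w\<close> is divergence-free. A general
  convecting field \<open>v\<close> covers both extrapolations.\<close>

lemma kinetic_energy_step:
  fixes \<Omega> :: "'a::euclidean_space set"
  assumes dom: "bounded_domain \<Omega>" and \<delta>t: "\<delta>t > 0"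
    and u: "Ck_closure 2 \<Omega> u0" "Ck_closure 2 \<Omega> u1" and v: "Ck_closure 1 \<Omega> v" and p: "Ck_closure 1 \<Omega> p"
    and bc: "zero_on_boundary \<Omega> u0" "zero_on_boundary \<Omega> u1"
    and mom: "\<And>x. x \<in> \<Omega> \<Longrightarrow> \<rho> *\<^sub>R ((u1 x - u0 x) /\<^sub>R (\<delta>t / 2)) + convB v (avg u1 u0) x
        = - grad p x + \<eta> *\<^sub>R lapl (avg u1 u0) x"
    and dv: "\<And>x. x \<in> \<Omega> \<Longrightarrow> divg (avg u1 u0) x = 0"
  shows "kinetic_energy \<rho> \<Omega> u1 - kinetic_energy \<rho> \<Omega> u0
      = - (\<delta>t / 2) * (\<eta> * (L2_norm \<Omega> (grad_abs (avg u1 u0)))\<^sup>2)"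
proof -
  have \<Omega>: "open \<Omega>" "bounded \<Omega>" using dom by (auto simp: bounded_domain_def)
  define w where "w = avg u1 u0"
  have w2: "Ck_closure 2 \<Omega> w" unfolding w_def using u by (intro Ck_closure_avg \<Omega>)
  note w1 = Ck_closure_2D[OF w2]
  have wb: "zero_on_boundary \<Omega> w" unfolding w_def using bc by (intro zero_on_boundary_avg)
  note C1prod = Ck_closure_1_prod[OF _ \<Omega>]
  note diff = Ck_closure_1_differentiable[OF \<Omega>(1)]
  \<comment> \<open>Fluxes of viscous work, pressure work and transported kinetic energy. Each
    contains a factor \<open>w\<close>, which vanishes at the boundary, while the other factors stay
    bounded.\<close>
  define Z where "Z = (\<lambda>y. \<Sum>i\<in>Basis. (partial i w y \<bullet> w y) *\<^sub>R i)"
  define P where "P = (\<lambda>y. p y *\<^sub>R w y)"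
  define Q where "Q = (\<lambda>y. (w y \<bullet> w y) *\<^sub>R v y)"
  define X where "X = (\<lambda>y. \<eta> *\<^sub>R Z y + ((- 1) *\<^sub>R P y + (- (1/2)) *\<^sub>R Q y))"
  have Z: "Ck_closure 1 \<Omega> Z" unfolding Z_def
    using w1 by (intro Ck_closure_sum Ck_closure_bounded_linear[OF _ bounded_linear_scaleR_left]
      C1prod[OF bounded_bilinear_inner] \<Omega>)
  have P: "Ck_closure 1 \<Omega> P" unfolding P_def
    using w1 p by (intro C1prod[OF bounded_bilinear_scaleR])
  have Q: "Ck_closure 1 \<Omega> Q" unfolding Q_def
    using w1 v by (intro C1prod[OF bounded_bilinear_scaleR] C1prod[OF bounded_bilinear_inner])
  have X: "Ck_closure 1 \<Omega> X" unfolding X_def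
    by (intro Ck_closure_add Ck_closure_scaleR_const \<Omega> Z P Q)
  have "zero_on_boundary \<Omega> Z" unfolding Z_def
    by (intro zero_on_boundary_sum_scaleR_Basis zero_on_boundary_inner wb Ck_closure_1_bounded \<Omega> w1)
  moreover have "tangential \<Omega> P" unfolding P_def
    by (intro tangential_scaleR tangential_zero_on_boundary wb Ck_closure_1_bounded \<Omega> p)
  moreover have "zero_on_boundary \<Omega> Q" unfolding Q_def
    by (intro zero_on_boundary_scaleR_left zero_on_boundary_inner wb Ck_closure_1_bounded \<Omega> w1 v)
  ultimately have Xt: "tangential \<Omega> X" unfolding X_def
    by (intro tangential_add tangential_scaleR_const) (auto intro: tangential_zero_on_boundary)
  have divX: "divg X x = \<eta> * (lapl w x \<bullet> w x + (grad_abs w x)\<^sup>2) - grad p x \<bullet> w x - convB v w x \<bullet> w x"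
    if x: "x \<in> \<Omega>" for x
  proof -
    have dZ: "(\<lambda>y. \<eta> *\<^sub>R Z y) differentiable (at x)" and dP: "(\<lambda>y. (- 1) *\<^sub>R P y) differentiable (at x)"
      and dQ: "(\<lambda>y. (- (1/2)) *\<^sub>R Q y) differentiable (at x)"
      by (rule diff[OF Ck_closure_scaleR_const[OF \<Omega>(1)] x], rule Z P Q)+
    have dPQ: "(\<lambda>y. (- 1) *\<^sub>R P y + (- (1/2)) *\<^sub>R Q y) differentiable (at x)"
      using dP dQ by (rule differentiable_add)
    have "divg X x = \<eta> * divg Z x + ((- 1) * divg P x + (- (1/2)) * divg Q x)"
      unfolding X_def divg_add[OF dZ dPQ] divg_add[OF dP dQ]
        divg_scaleR_const[OF diff[OF Z x]] divg_scaleR_const[OF diff[OF P x]] divg_scaleR_const[OF diff[OF Q x]] ..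
    moreover have "divg Z x = lapl w x \<bullet> w x + (grad_abs w x)\<^sup>2"
      unfolding Z_def by (intro divg_partial_inner diff w1 x)
    moreover have "divg P x = grad p x \<bullet> w x"
      unfolding P_def divg_scaleR[OF diff[OF p x] diff[OF w1(1) x]] using dv[OF x] by (simp add: w_def)
    moreover have "convB v w x \<bullet> w x = 1/2 * divg Q x"
      unfolding Q_def by (intro convB_inner diff[OF v x] diff[OF w1(1) x])
    ultimately show ?thesis by simp
  qed
  have pt: "\<rho> / 2 * (norm (u1 x))\<^sup>2 - \<rho> / 2 * (norm (u0 x))\<^sup>2
      = (\<delta>t / 2) * (divg X x - \<eta> * (norm (grad_abs w x))\<^sup>2)" if x: "x \<in> \<Omega>" for x
  proof -
    have "(\<rho> *\<^sub>R ((u1 x - u0 x) /\<^sub>R (\<delta>t / 2))) \<bullet> w x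
        = (- grad p x + \<eta> *\<^sub>R lapl w x - convB v w x) \<bullet> w x"
      using mom[OF x] unfolding w_def by (metis add_diff_cancel_right')
    also have "\<dots> = divg X x - \<eta> * (norm (grad_abs w x))\<^sup>2"
      unfolding divX[OF x] by (simp add: inner_diff_left inner_add_left algebra_simps)
    finally have "(\<delta>t / 2) * (divg X x - \<eta> * (norm (grad_abs w x))\<^sup>2)
        = (\<delta>t / 2) * ((\<rho> *\<^sub>R ((u1 x - u0 x) /\<^sub>R (\<delta>t / 2))) \<bullet> w x)" by simp
    also have "\<dots> = \<rho> * ((u1 x - u0 x) \<bullet> w x)" using \<delta>t by simp
    also have "(u1 x - u0 x) \<bullet> w x = (1/2) * ((norm (u1 x))\<^sup>2 - (norm (u0 x))\<^sup>2)"
      by (simp add: w_def avg_def power2_norm_eq_inner inner_add_right inner_diff_left inner_commute[of "u0 x" "u1 x"])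
    finally show ?thesis by (simp add: algebra_simps)
  qed
  have ui: "set_integrable lborel \<Omega> (\<lambda>x. \<rho> / 2 * (norm (f x))\<^sup>2)" if "Ck_closure 2 \<Omega> f" for f :: "'a \<Rightarrow> 'a"
    unfolding power2_norm_eq_inner
    using Ck_closure_1D(1)[OF C1prod[OF bounded_bilinear_inner Ck_closure_2D(1)[OF that] Ck_closure_2D(1)[OF that]]]
    by (intro set_integrable_mult_right impI set_integrable_uniformly_continuous \<Omega>)
  \<comment> \<open>Squaring removes the root in \<open>grad_abs\<close>, leaving a sum of products
    of uniformly continuous functions.\<close>
  have gi: "set_integrable lborel \<Omega> (\<lambda>x. (norm (grad_abs w x))\<^sup>2)"
  proof -
    have "uniformly_continuous_on \<Omega> (\<lambda>x. \<Sum>i\<in>Basis. partial i w x \<bullet> partial i w x)"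
      by (intro uniformly_continuous_on_sum Ck_closure_1D(1) C1prod[OF bounded_bilinear_inner] w1)
    then have "set_integrable lborel \<Omega> (\<lambda>x. \<Sum>i\<in>Basis. partial i w x \<bullet> partial i w x)"
      by (intro set_integrable_uniformly_continuous \<Omega>)
    then show ?thesis by (simp add: grad_abs_def sum_nonneg power2_norm_eq_inner)
  qed
  have di: "set_integrable lborel \<Omega> (divg X)"
    by (intro set_integrable_uniformly_continuous \<Omega> uniformly_continuous_on_divg X)
  have "kinetic_energy \<rho> \<Omega> u1 - kinetic_energy \<rho> \<Omega> u0
      = (LINT x:\<Omega>|lborel. \<rho> / 2 * (norm (u1 x))\<^sup>2 - \<rho> / 2 * (norm (u0 x))\<^sup>2)"
    unfolding kinetic_energy_def using ui u by (intro set_integral_diff(2)[symmetric])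
  also have "\<dots> = (LINT x:\<Omega>|lborel. (\<delta>t / 2) * (divg X x - \<eta> * (norm (grad_abs w x))\<^sup>2))"
    using pt \<Omega>(1) by (intro set_lebesgue_integral_cong) auto
  also have "\<dots> = (\<delta>t / 2) * ((LINT x:\<Omega>|lborel. divg X x) - \<eta> * (LINT x:\<Omega>|lborel. (norm (grad_abs w x))\<^sup>2))"
    using di gi by (simp add: set_integral_diff)
  also have "(LINT x:\<Omega>|lborel. divg X x) = 0" by (rule integral_divg_tangential[OF dom X Xt])
  finally show ?thesis by (simp add: w_def power2_L2_norm)
qed

section \<open>The energy law of the phase-field step with pressure correction\<close>

lemma grad_add:
  assumes "f differentiable (at x)" "g differentiable (at x)"
  shows "grad (\<lambda>y. f y + g y) x = grad f x + grad g x"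
  by (simp add: grad_def partial_add[OF assms] scaleR_left_distrib sum.distrib)

lemma grad_scaleR_const:
  assumes "f differentiable (at x)"
  shows "grad (\<lambda>y. c *\<^sub>R f y) x = c *\<^sub>R grad f x"
  by (simp add: grad_def partial_bounded_linear[OF bounded_linear_scaleR_right assms, simplified] scaleR_sum_right)

text \<open>Factoring a difference of squares shows that the discrete derivative is the exact
  difference quotient of the double well. The chain rule thus holds in discrete time without a
  remainder.\<close>

lemma dwell_diff: "dwell a - dwell b = dwell_discr_deriv a b * (a - b)"
  by (simp add: dwell_def dwell_discr_deriv_def power2_eq_square field_simps)

lemma uniformly_continuous_on_dwell:
  fixes f :: "'a::euclidean_space \<Rightarrow> real"
  assumes "open \<Omega>" "bounded \<Omega>" "Ck_closure 1 \<Omega> f"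
  shows "uniformly_continuous_on \<Omega> (\<lambda>x. dwell (f x))"
proof -
  note uc = uniformly_continuous_on_bilinear[OF bounded_bilinear_mult assms(2)]
  have 1: "uniformly_continuous_on \<Omega> (\<lambda>x. f x * f x - 1)"
    using Ck_closure_1D(1)[OF assms(3)]
    by (intro uniformly_continuous_on_diff uniformly_continuous_on_const uc)
  have "uniformly_continuous_on \<Omega> (\<lambda>x. (1/4) * ((f x * f x - 1) * (f x * f x - 1)))"
    by (intro uniformly_continuous_on_cmul_left uc 1)
  then show ?thesis by (simp add: dwell_def[abs_def] power2_eq_square)
qed

text \<open>The pressure equation says precisely that \<open>grad p + \<phi> grad \<mu>\<close> is
  divergence-free, so any multiple may be subtracted. It is applied with
  \<open>c = \<delta>t / \<rho>\<close> for the corrected velocity and with half of that for the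
  mean velocity.\<close>

lemma divg_pressure_correction:
  assumes \<Omega>: "open \<Omega>" "bounded \<Omega>"
    and u: "Ck_closure 1 \<Omega> u" and \<phi>: "Ck_closure 1 \<Omega> \<phi>"
    and \<mu>: "Ck_closure 2 \<Omega> \<mu>" and p: "Ck_closure 2 \<Omega> p"
    and eq_p: "\<And>x. x \<in> \<Omega> \<Longrightarrow> - lapl p x - divg (\<lambda>y. \<phi> y *\<^sub>R grad \<mu> y) x = 0"
    and w: "\<And>x. x \<in> \<Omega> \<Longrightarrow> w x = u x - c *\<^sub>R (grad p x + \<phi> x *\<^sub>R grad \<mu> x)"
    and x: "x \<in> \<Omega>"
  shows "divg w x = divg u x"
proof -
  note diff = Ck_closure_1_differentiable[OF \<Omega>(1)]
  note gp = Ck_closure_grad[OF \<Omega>(1) p]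
  define E where "E = (\<lambda>y. \<phi> y *\<^sub>R grad \<mu> y)"
  have E1: "Ck_closure 1 \<Omega> E"
    unfolding E_def by (rule Ck_closure_1_prod[OF bounded_bilinear_scaleR \<Omega> \<phi> Ck_closure_grad[OF \<Omega>(1) \<mu>]])
  have pE: "Ck_closure 1 \<Omega> (\<lambda>y. grad p y + E y)" by (intro Ck_closure_add \<Omega> gp E1)
  have "divg w x = divg (\<lambda>y. u y + (- c) *\<^sub>R (grad p y + E y)) x"
    using \<Omega>(1) x by (rule divg_cong_open) (simp add: w E_def)
  also have "\<dots> = divg u x + (- c) * (divg (grad p) x + divg E x)"
    unfolding divg_add[OF diff[OF u x] diff[OF Ck_closure_scaleR_const[OF \<Omega>(1) pE] x]]
      divg_scaleR_const[OF diff[OF pE x]] divg_add[OF diff[OF gp x] diff[OF E1 x]] ..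
  also have "divg (grad p) x + divg E x = 0"
    using eq_p[OF x] by (simp add: E_def lapl_eq_divg_grad[OF \<Omega>(1) p x])
  finally show ?thesis by simp
qed

text \<open>The additional mobility and pressure terms of the decoupled phase equation are what
  turns the velocity \<open>u_s\<close> in its flux into the mean of \<open>u_s\<close> and
  \<open>u_ss\<close>. In this form the power lost by the velocity to the capillary force is the
  power gained by the phase field.\<close>

lemma total_energy_step:
  fixes \<Omega> :: "'a::euclidean_space set"
  assumes dom: "bounded_domain \<Omega>" and pos: "\<rho> > 0" "\<epsilon> > 0" "\<delta>t > 0"
    and M: "\<And>s. M s \<ge> 0"
    and u: "Ck_closure 2 \<Omega> u_s" "Ck_closure 2 \<Omega> u_ss"
    and \<phi>: "Ck_closure 1 \<Omega> \<phi>_bar" "Ck_closure 2 \<Omega> \<phi>_s" "Ck_closure 2 \<Omega> \<phi>_ss"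
    and \<mu>: "Ck_closure 2 \<Omega> \<mu>" "Ck_closure 1 \<Omega> (\<lambda>x. M (\<phi>_bar x))" and p: "Ck_closure 2 \<Omega> p"
    and div: "\<And>x. x \<in> \<Omega> \<Longrightarrow> divg u_s x = 0"
    and bc_u: "zero_on_boundary \<Omega> u_s" "zero_on_boundary \<Omega> u_ss"
    and bc: "zero_normal_derivative \<Omega> \<phi>_s" "zero_normal_derivative \<Omega> \<phi>_ss"
      "zero_normal_derivative \<Omega> \<mu>" "zero_normal_derivative \<Omega> p"
    and eq_\<phi>: "\<And>x. x \<in> \<Omega> \<Longrightarrow>
      (\<phi>_ss x - \<phi>_s x) / \<delta>t + divg (\<lambda>y. \<phi>_bar y *\<^sub>R u_s y) x
        = divg (\<lambda>y. (M (\<phi>_bar y) + \<delta>t / (2 * \<rho>) * (\<phi>_bar y)\<^sup>2) *\<^sub>R grad \<mu> y) x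
          + \<delta>t / (2 * \<rho>) * divg (\<lambda>y. \<phi>_bar y *\<^sub>R grad p y) x"
    and eq_\<mu>: "\<And>x. x \<in> \<Omega> \<Longrightarrow>
      \<mu> x = - (\<gamma> * \<epsilon> / 2) * (lapl \<phi>_ss x + lapl \<phi>_s x)
        + \<gamma> / \<epsilon> * dwell_discr_deriv (\<phi>_ss x) (\<phi>_s x)"
    and eq_p: "\<And>x. x \<in> \<Omega> \<Longrightarrow> - lapl p x - divg (\<lambda>y. \<phi>_bar y *\<^sub>R grad \<mu> y) x = 0"
    and eq_u: "\<And>x. x \<in> \<Omega> \<Longrightarrow>
      u_ss x = u_s x - (\<delta>t / \<rho>) *\<^sub>R (grad p x + \<phi>_bar x *\<^sub>R grad \<mu> x)"
  shows "total_energy \<rho> \<gamma> \<epsilon> \<Omega> u_ss \<phi>_ss - total_energy \<rho> \<gamma> \<epsilon> \<Omega> u_s \<phi>_s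
      = - \<delta>t * (L2_norm \<Omega> (\<lambda>x. sqrt (M (\<phi>_bar x)) *\<^sub>R grad \<mu> x))\<^sup>2"
proof -
  have \<Omega>: "open \<Omega>" "bounded \<Omega>" using dom by (auto simp: bounded_domain_def)
  note C1prod = Ck_closure_1_prod[OF _ \<Omega>]
  note C1scaleR = C1prod[OF bounded_bilinear_scaleR]
  note diff = Ck_closure_1_differentiable[OF \<Omega>(1)]
  note bdd = Ck_closure_1_bounded[OF \<Omega>(2)]
  note g\<mu> = Ck_closure_grad[OF \<Omega>(1) \<mu>(1)] and gp = Ck_closure_grad[OF \<Omega>(1) p]
    and gs = Ck_closure_grad[OF \<Omega>(1) \<phi>(2)] and gss = Ck_closure_grad[OF \<Omega>(1) \<phi>(3)]
  note \<phi>1 = Ck_closure_2D(1)[OF \<phi>(2)] Ck_closure_2D(1)[OF \<phi>(3)]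
  note \<mu>1 = Ck_closure_2D(1)[OF \<mu>(1)] and p1 = Ck_closure_2D(1)[OF p]
    and u1 = Ck_closure_2D(1)[OF u(1)] Ck_closure_2D(1)[OF u(2)]
  \<comment> \<open>Half of the factor in the velocity correction: the mean velocity
    \<open>w\<close> carries out half of the update.\<close>
  define c where "c = \<delta>t / (2 * \<rho>)"
  define w where "w = avg u_ss u_s"
  define d where "d = (\<lambda>y. \<phi>_ss y + (- 1) *\<^sub>R \<phi>_s y)"
  define G where "G = (\<lambda>y. grad \<phi>_ss y + grad \<phi>_s y)"
  define A where "A = (\<lambda>y. \<phi>_bar y *\<^sub>R u_s y)"
  define B where "B = (\<lambda>y. (M (\<phi>_bar y) + c * (\<phi>_bar y)\<^sup>2) *\<^sub>R grad \<mu> y)"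
  define C where "C = (\<lambda>y. \<phi>_bar y *\<^sub>R grad p y)"
  \<comment> \<open>The total flux of the phase field, arranged so that
    \<open>\<delta>t * divg J\<close> is the increment \<open>d\<close>. Differences are written
    with factors \<open>- 1\<close> to match the rules for sums and multiples.\<close>
  define J where "J = (\<lambda>y. (- 1) *\<^sub>R A y + (B y + c *\<^sub>R C y))"
  \<comment> \<open>The fluxes produced by testing: pressure against the mean velocity, the gradient
    of the phase field against its increment, and the phase flux against the chemical
    potential.\<close>
  define X where "X = (\<lambda>y. (- \<delta>t) *\<^sub>R (p y *\<^sub>R w y) +
      ((\<gamma> * \<epsilon> / 2) *\<^sub>R (d y *\<^sub>R G y) + \<delta>t *\<^sub>R (\<mu> y *\<^sub>R J y)))"

  have m1: "Ck_closure 1 \<Omega> (\<lambda>y. M (\<phi>_bar y) + c * (\<phi>_bar y)\<^sup>2)"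
    unfolding power2_eq_square
    using Ck_closure_add[OF \<Omega>(1) \<mu>(2) Ck_closure_scaleR_const[OF \<Omega>(1) C1prod[OF bounded_bilinear_mult \<phi>(1) \<phi>(1)], of c]]
    by simp
  have w1: "Ck_closure 1 \<Omega> w" unfolding w_def by (rule Ck_closure_avg[OF \<Omega>(1) u1(2) u1(1)])
  have d1: "Ck_closure 1 \<Omega> d" unfolding d_def
    by (intro Ck_closure_add Ck_closure_scaleR_const \<Omega> \<phi>1)
  have G1: "Ck_closure 1 \<Omega> G" unfolding G_def by (intro Ck_closure_add \<Omega> gs gss)
  have A1: "Ck_closure 1 \<Omega> A" unfolding A_def by (intro C1scaleR \<phi> u1)
  have B1: "Ck_closure 1 \<Omega> B" unfolding B_def by (intro C1scaleR m1 g\<mu>)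
  have C1: "Ck_closure 1 \<Omega> C" unfolding C_def by (intro C1scaleR \<phi> gp)
  have J1: "Ck_closure 1 \<Omega> J" unfolding J_def
    by (intro Ck_closure_add Ck_closure_scaleR_const \<Omega> A1 B1 C1)
  note pw1 = C1scaleR[OF p1 w1] and dG1 = C1scaleR[OF d1 G1] and \<mu>J1 = C1scaleR[OF \<mu>1 J1]
  have X1: "Ck_closure 1 \<Omega> X" unfolding X_def
    by (intro Ck_closure_add Ck_closure_scaleR_const \<Omega> pw1 dG1 \<mu>J1)

  have "tangential \<Omega> A" unfolding A_def
    by (intro tangential_scaleR tangential_zero_on_boundary bdd \<phi> bc_u)
  moreover have "tangential \<Omega> B" unfolding B_def
    by (rule tangential_scaleR[OF bdd[OF m1]]) (simp add: tangential_grad bc)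
  moreover have "tangential \<Omega> C" unfolding C_def
    by (rule tangential_scaleR[OF bdd[OF \<phi>(1)]]) (simp add: tangential_grad bc)
  ultimately have Jt: "tangential \<Omega> J" unfolding J_def
    by (intro tangential_add tangential_scaleR_const)
  have Gt: "tangential \<Omega> G" unfolding G_def
    by (rule tangential_add) (simp_all add: tangential_grad bc)
  have wt: "tangential \<Omega> w" unfolding w_def
    by (intro tangential_zero_on_boundary zero_on_boundary_avg bc_u)
  have Xt: "tangential \<Omega> X" unfolding X_def
    using tangential_scaleR[OF bdd[OF p1] wt] tangential_scaleR[OF bdd[OF d1] Gt]
      tangential_scaleR[OF bdd[OF \<mu>1] Jt]
    by (intro tangential_add tangential_scaleR_const)

  have w: "w x = u_s x - c *\<^sub>R (grad p x + \<phi>_bar x *\<^sub>R grad \<mu> x)" if "x \<in> \<Omega>" for x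
  proof -
    define v where "v = grad p x + \<phi>_bar x *\<^sub>R grad \<mu> x"
    have "w x = (1/2) *\<^sub>R ((2::real) *\<^sub>R u_s x - (2 * c) *\<^sub>R v)"
      unfolding w_def avg_def eq_u[OF that] v_def[symmetric] by (simp add: c_def scaleR_2)
    then show ?thesis unfolding v_def[symmetric] by (simp add: scaleR_diff_right)
  qed
  \<comment> \<open>With \<open>w\<close> inserted, the terms with the factor \<open>c\<close> are
    absorbed: only transport by the mean velocity and the diffusion with mobility \<open>M\<close>
    are left.\<close>
  have J: "J x = - \<phi>_bar x *\<^sub>R w x + M (\<phi>_bar x) *\<^sub>R grad \<mu> x" if "x \<in> \<Omega>" for x
    unfolding J_def A_def B_def C_def w[OF that]
    by (simp add: algebra_simps power2_eq_square)
  have divw: "divg w x = 0" if x: "x \<in> \<Omega>" for x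
    using divg_pressure_correction[OF \<Omega> u1(1) \<phi>(1) \<mu>(1) p eq_p w x] div[OF x] by simp
  have divJ: "\<delta>t * divg J x = d x" if x: "x \<in> \<Omega>" for x
  proof -
    have cC1: "Ck_closure 1 \<Omega> (\<lambda>y. c *\<^sub>R C y)" by (intro Ck_closure_scaleR_const \<Omega> C1)
    have "divg J x = (- 1) * divg A x + (divg B x + c * divg C x)"
      unfolding J_def divg_add[OF diff[OF Ck_closure_scaleR_const[OF \<Omega>(1) A1] x] diff[OF Ck_closure_add[OF \<Omega>(1) B1 cC1] x]]
        divg_add[OF diff[OF B1 x] diff[OF cC1 x]] divg_scaleR_const[OF diff[OF A1 x]] divg_scaleR_const[OF diff[OF C1 x]] ..
    also have "\<dots> = (\<phi>_ss x - \<phi>_s x) / \<delta>t"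
      using eq_\<phi>[OF x] unfolding A_def B_def C_def c_def by linarith
    finally show ?thesis using pos by (simp add: d_def)
  qed
  have gd: "grad d x = grad \<phi>_ss x - grad \<phi>_s x" if x: "x \<in> \<Omega>" for x
    unfolding d_def grad_add[OF diff[OF \<phi>1(2) x] diff[OF Ck_closure_scaleR_const[OF \<Omega>(1) \<phi>1(1)] x]]
      grad_scaleR_const[OF diff[OF \<phi>1(1) x]] by simp
  have divX: "divg X x = - \<delta>t * (grad p x \<bullet> w x)
      + \<gamma> * \<epsilon> / 2 * (d x * (lapl \<phi>_ss x + lapl \<phi>_s x) + ((norm (grad \<phi>_ss x))\<^sup>2 - (norm (grad \<phi>_s x))\<^sup>2))
      + (\<mu> x * d x + \<delta>t * (M (\<phi>_bar x) * (norm (grad \<mu> x))\<^sup>2 - \<phi>_bar x * (grad \<mu> x \<bullet> w x)))"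
    if x: "x \<in> \<Omega>" for x
  proof -
    note s = Ck_closure_scaleR_const[OF \<Omega>(1)]
    have "divg X x = - \<delta>t * divg (\<lambda>y. p y *\<^sub>R w y) x
        + (\<gamma> * \<epsilon> / 2 * divg (\<lambda>y. d y *\<^sub>R G y) x + \<delta>t * divg (\<lambda>y. \<mu> y *\<^sub>R J y) x)"
      unfolding X_def divg_add[OF diff[OF s[OF pw1] x] diff[OF Ck_closure_add[OF \<Omega>(1) s[OF dG1] s[OF \<mu>J1]] x]]
        divg_add[OF diff[OF s[OF dG1] x] diff[OF s[OF \<mu>J1] x]]
        divg_scaleR_const[OF diff[OF pw1 x]] divg_scaleR_const[OF diff[OF dG1 x]] divg_scaleR_const[OF diff[OF \<mu>J1 x]] ..
    moreover have "divg (\<lambda>y. p y *\<^sub>R w y) x = grad p x \<bullet> w x"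
      unfolding divg_scaleR[OF diff[OF p1 x] diff[OF w1 x]] divw[OF x] by simp
    moreover have "divg (\<lambda>y. d y *\<^sub>R G y) x
        = d x * (lapl \<phi>_ss x + lapl \<phi>_s x) + ((norm (grad \<phi>_ss x))\<^sup>2 - (norm (grad \<phi>_s x))\<^sup>2)"
      unfolding divg_scaleR[OF diff[OF d1 x] diff[OF G1 x]] gd[OF x]
      unfolding G_def divg_add[OF diff[OF gss x] diff[OF gs x]]
        lapl_eq_divg_grad[OF \<Omega>(1) \<phi>(2) x] lapl_eq_divg_grad[OF \<Omega>(1) \<phi>(3) x]
      by (simp add: power2_norm_eq_inner inner_diff_left inner_diff_right inner_add_right inner_commute)
    moreover have "\<delta>t * divg (\<lambda>y. \<mu> y *\<^sub>R J y) x
        = \<mu> x * d x + \<delta>t * (M (\<phi>_bar x) * (norm (grad \<mu> x))\<^sup>2 - \<phi>_bar x * (grad \<mu> x \<bullet> w x))"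
      unfolding divg_scaleR[OF diff[OF \<mu>1 x] diff[OF J1 x]] divJ[OF x, symmetric] J[OF x]
      by (simp add: power2_norm_eq_inner inner_add_right algebra_simps)
    ultimately show ?thesis by simp
  qed
  define K where "K = (\<lambda>(f :: 'a \<Rightarrow> 'a) x. \<rho> / 2 * (norm (f x))\<^sup>2)"
  define F where "F = (\<lambda>f (x :: 'a). \<epsilon> / 2 * (norm (grad f x))\<^sup>2 + 1 / \<epsilon> * dwell (f x))"
  define R where "R = (\<lambda>x. (norm (sqrt (M (\<phi>_bar x)) *\<^sub>R grad \<mu> x))\<^sup>2)"
  \<comment> \<open>Regularity is given for \<open>M (\<phi>_bar x)\<close>; its root may fail to be
    differentiable where the mobility vanishes. Nonnegativity of \<open>M\<close> allows the root to
    be squared away before integrability is shown.\<close>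
  have R: "R x = M (\<phi>_bar x) * (norm (grad \<mu> x))\<^sup>2" for x
    using M by (simp add: R_def power_mult_distrib)
  have pt: "(K u_ss x - K u_s x) + \<gamma> * (F \<phi>_ss x - F \<phi>_s x) = divg X x - \<delta>t * R x" if x: "x \<in> \<Omega>" for x
  proof -
    have "K u_ss x - K u_s x = \<rho> * ((1/2) * ((norm (u_ss x))\<^sup>2 - (norm (u_s x))\<^sup>2))"
      by (simp add: K_def algebra_simps)
    also have "(1/2) * ((norm (u_ss x))\<^sup>2 - (norm (u_s x))\<^sup>2) = (u_ss x - u_s x) \<bullet> w x"
      by (simp add: w_def avg_def power2_norm_eq_inner inner_add_right inner_diff_left inner_commute[of "u_s x" "u_ss x"])
    also have "u_ss x - u_s x = - (\<delta>t / \<rho>) *\<^sub>R (grad p x + \<phi>_bar x *\<^sub>R grad \<mu> x)"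
      by (simp add: eq_u[OF x])
    also have "\<rho> * (\<dots> \<bullet> w x) = - \<delta>t * (grad p x \<bullet> w x) - \<delta>t * (\<phi>_bar x * (grad \<mu> x \<bullet> w x))"
      unfolding inner_scaleR_left inner_add_left using pos(1) by (simp add: field_simps)
    finally have k: "K u_ss x - K u_s x = - \<delta>t * (grad p x \<bullet> w x) - \<delta>t * (\<phi>_bar x * (grad \<mu> x \<bullet> w x))" .
    have "\<gamma> * (F \<phi>_ss x - F \<phi>_s x) = \<gamma> * \<epsilon> / 2 * ((norm (grad \<phi>_ss x))\<^sup>2 - (norm (grad \<phi>_s x))\<^sup>2)
        + \<gamma> / \<epsilon> * (dwell (\<phi>_ss x) - dwell (\<phi>_s x))"
      using pos(2) by (simp add: F_def field_simps)
    also have "dwell (\<phi>_ss x) - dwell (\<phi>_s x) = dwell_discr_deriv (\<phi>_ss x) (\<phi>_s x) * d x"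
      by (simp add: dwell_diff d_def)
    finally have f: "\<gamma> * (F \<phi>_ss x - F \<phi>_s x) = \<gamma> * \<epsilon> / 2 * ((norm (grad \<phi>_ss x))\<^sup>2 - (norm (grad \<phi>_s x))\<^sup>2)
        + \<gamma> / \<epsilon> * (dwell_discr_deriv (\<phi>_ss x) (\<phi>_s x) * d x)" .
    \<comment> \<open>Inserting the equation for \<open>\<mu>\<close> into
      \<open>\<mu> x * d x\<close> cancels the Laplacians in the divergence and leaves the discrete
      derivative times \<open>d\<close>, which is the change of the double well.\<close>
    show ?thesis unfolding k f divX[OF x] R eq_\<mu>[OF x] by (simp add: algebra_simps)
  qed
  have Ki: "set_integrable lborel \<Omega> (K f)" if "Ck_closure 1 \<Omega> f" for f :: "'a \<Rightarrow> 'a"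
    unfolding K_def power2_norm_eq_inner
    using Ck_closure_1D(1)[OF C1prod[OF bounded_bilinear_inner that that]]
    by (intro set_integrable_mult_right impI set_integrable_uniformly_continuous \<Omega>)
  have Fi: "set_integrable lborel \<Omega> (F f)" if f: "Ck_closure 2 \<Omega> f" for f
    unfolding F_def power2_norm_eq_inner
    using Ck_closure_1D(1)[OF C1prod[OF bounded_bilinear_inner Ck_closure_grad[OF \<Omega>(1) f] Ck_closure_grad[OF \<Omega>(1) f]]]
      uniformly_continuous_on_dwell[OF \<Omega> Ck_closure_2D(1)[OF f]]
    by (intro set_integral_add(1) set_integrable_mult_right impI set_integrable_uniformly_continuous \<Omega>)
  have Ri: "set_integrable lborel \<Omega> R"
    unfolding R[abs_def] power2_norm_eq_inner
    by (intro set_integrable_uniformly_continuous \<Omega> Ck_closure_1D(1) C1prod[OF bounded_bilinear_mult]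
        C1prod[OF bounded_bilinear_inner] \<mu> g\<mu>)
  have Xi: "set_integrable lborel \<Omega> (divg X)"
    by (intro set_integrable_uniformly_continuous \<Omega> uniformly_continuous_on_divg X1)
  have "total_energy \<rho> \<gamma> \<epsilon> \<Omega> u_ss \<phi>_ss - total_energy \<rho> \<gamma> \<epsilon> \<Omega> u_s \<phi>_s
      = ((LINT x:\<Omega>|lborel. K u_ss x) - (LINT x:\<Omega>|lborel. K u_s x))
        + \<gamma> * ((LINT x:\<Omega>|lborel. F \<phi>_ss x) - (LINT x:\<Omega>|lborel. F \<phi>_s x))"
    unfolding total_energy_def kinetic_energy_def free_energy_def K_def F_def by (simp add: right_diff_distrib)
  also have "\<dots> = (LINT x:\<Omega>|lborel. (K u_ss x - K u_s x) + \<gamma> * (F \<phi>_ss x - F \<phi>_s x))"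
    using Ki[OF u1(1)] Ki[OF u1(2)] Fi[OF \<phi>(2)] Fi[OF \<phi>(3)]
    by (simp add: set_integral_add set_integral_diff)
  also have "\<dots> = (LINT x:\<Omega>|lborel. divg X x - \<delta>t * R x)"
    using pt \<Omega>(1) by (intro set_lebesgue_integral_cong) auto
  also have "\<dots> = (LINT x:\<Omega>|lborel. divg X x) - \<delta>t * (LINT x:\<Omega>|lborel. R x)"
    using Xi Ri by (simp add: set_integral_diff)
  also have "(LINT x:\<Omega>|lborel. divg X x) = 0" by (rule integral_divg_tangential[OF dom X1 Xt])
  finally show ?thesis by (simp add: power2_L2_norm R_def)
qed


theorem theorem4p2:
  fixes \<Omega> :: "'a::euclidean_space set"
    and \<rho> \<eta> \<gamma> \<epsilon> \<delta>t :: real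
    and M :: "real \<Rightarrow> real"
    and u_prev u_n u_s u_ss u_new :: "'a \<Rightarrow> 'a"
    and \<phi>_prev \<phi>_n \<phi>_s \<phi>_ss \<phi>_new \<phi>_bar \<mu> p1 p2 p3 :: "'a \<Rightarrow> real"
  assumes dom: "bounded_domain \<Omega>"
    and pos: "\<rho> > 0" "\<eta> > 0" "\<gamma> > 0" "\<epsilon> > 0" "\<delta>t > 0"
    and M_nonneg: "\<And>s. M s \<ge> 0"
    and \<phi>_bar: "\<phi>_bar = extrap (1/2) \<phi>_n \<phi>_prev"
    and reg_u: "Ck_closure 1 \<Omega> u_prev" "Ck_closure 2 \<Omega> u_n" "Ck_closure 2 \<Omega> u_s"
      "Ck_closure 2 \<Omega> u_ss" "Ck_closure 2 \<Omega> u_new"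
    and reg_\<phi>: "Ck_closure 1 \<Omega> \<phi>_prev" "Ck_closure 2 \<Omega> \<phi>_n" "Ck_closure 2 \<Omega> \<phi>_ss"
    and reg_\<mu>: "Ck_closure 2 \<Omega> \<mu>" "Ck_closure 1 \<Omega> (\<lambda>x. M (\<phi>_bar x))"
    and reg_p: "Ck_closure 1 \<Omega> p1" "Ck_closure 2 \<Omega> p2" "Ck_closure 1 \<Omega> p3"
    \<comment> \<open>data\<close>
    and data_div: "\<And>x. x \<in> \<Omega> \<Longrightarrow> divg u_prev x = 0" "\<And>x. x \<in> \<Omega> \<Longrightarrow> divg u_n x = 0"
    and data_bc_u: "zero_on_boundary \<Omega> u_prev" "zero_on_boundary \<Omega> u_n"
    and data_bc_\<phi>: "zero_normal_derivative \<Omega> \<phi>_prev" "zero_normal_derivative \<Omega> \<phi>_n"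
    \<comment> \<open>step 1\<close>
    and step1_\<phi>: "\<phi>_s = \<phi>_n"
    and step1_mom: "\<And>x. x \<in> \<Omega> \<Longrightarrow>
      \<rho> *\<^sub>R ((u_s x - u_n x) /\<^sub>R (\<delta>t / 2)) + convB (extrap (1/4) u_n u_prev) (avg u_s u_n) x
        = - grad p1 x + \<eta> *\<^sub>R lapl (avg u_s u_n) x"
    and step1_div: "\<And>x. x \<in> \<Omega> \<Longrightarrow> divg (avg u_s u_n) x = 0"
    and step1_bc: "zero_on_boundary \<Omega> u_s"
    \<comment> \<open>step 2.1\<close>
    and step2_\<phi>: "\<And>x. x \<in> \<Omega> \<Longrightarrow>
      (\<phi>_ss x - \<phi>_s x) / \<delta>t + divg (\<lambda>y. \<phi>_bar y *\<^sub>R u_s y) x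
        = divg (\<lambda>y. (M (\<phi>_bar y) + \<delta>t / (2 * \<rho>) * (\<phi>_bar y)\<^sup>2) *\<^sub>R grad \<mu> y) x
          + \<delta>t / (2 * \<rho>) * divg (\<lambda>y. \<phi>_bar y *\<^sub>R grad p2 y) x"
    and step2_\<mu>: "\<And>x. x \<in> \<Omega> \<Longrightarrow>
      \<mu> x = - (\<gamma> * \<epsilon> / 2) * (lapl \<phi>_ss x + lapl \<phi>_s x)
        + \<gamma> / \<epsilon> * dwell_discr_deriv (\<phi>_ss x) (\<phi>_s x)"
    and step2_p: "\<And>x. x \<in> \<Omega> \<Longrightarrow> - lapl p2 x - divg (\<lambda>y. \<phi>_bar y *\<^sub>R grad \<mu> y) x = 0"
    and step2_bc: "zero_normal_derivative \<Omega> \<mu>" "zero_normal_derivative \<Omega> \<phi>_ss"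
      "zero_normal_derivative \<Omega> p2"
    \<comment> \<open>step 2.2\<close>
    and step2_u: "\<And>x. x \<in> \<Omega> \<Longrightarrow>
      u_ss x = u_s x - (\<delta>t / \<rho>) *\<^sub>R (grad p2 x + \<phi>_bar x *\<^sub>R grad \<mu> x)"
    and step2_bc_u: "zero_on_boundary \<Omega> u_ss"
    \<comment> \<open>step 3\<close>
    and step3_\<phi>: "\<phi>_new = \<phi>_ss"
    and step3_mom: "\<And>x. x \<in> \<Omega> \<Longrightarrow>
      \<rho> *\<^sub>R ((u_new x - u_ss x) /\<^sub>R (\<delta>t / 2)) + convB (extrap (3/4) u_n u_prev) (avg u_new u_ss) x
        = - grad p3 x + \<eta> *\<^sub>R lapl (avg u_ss u_new) x"
    and step3_div: "\<And>x. x \<in> \<Omega> \<Longrightarrow> divg u_new x = 0"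
    and step3_bc: "zero_on_boundary \<Omega> u_new"
  shows "total_energy \<rho> \<gamma> \<epsilon> \<Omega> u_new \<phi>_new - total_energy \<rho> \<gamma> \<epsilon> \<Omega> u_n \<phi>_n
    \<le> - (\<delta>t / 2) * (\<eta> * (L2_norm \<Omega> (grad_abs (avg u_s u_n)))\<^sup>2
        + \<eta> * (L2_norm \<Omega> (grad_abs (avg u_new u_ss)))\<^sup>2
        + 2 * (L2_norm \<Omega> (\<lambda>x. sqrt (M (\<phi>_bar x)) *\<^sub>R grad \<mu> x))\<^sup>2)"
proof -
  have \<Omega>: "open \<Omega>" and bdd: "bounded \<Omega>" using dom by (auto simp: bounded_domain_def)
  note u1 = Ck_closure_2D(1)[OF reg_u(2)] reg_u(1)
  \<comment> \<open>The third momentum equation has the two velocities in opposite orders in its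
    convection and viscous terms.\<close>
  have avg_comm: "avg g h = avg h g" for g h :: "'a \<Rightarrow> 'a"
    by (simp add: avg_def fun_eq_iff add.commute)
  \<comment> \<open>Step 1 constrains only the mean velocity; together with the divergence-free
    datum \<open>u_n\<close> this determines the divergence of \<open>u_s\<close>.\<close>
  have div_s: "divg u_s x = 0" if x: "x \<in> \<Omega>" for x
  proof -
    note d = Ck_closure_1_differentiable[OF \<Omega> Ck_closure_2D(1) x]
    have "divg (avg u_s u_n) x = (1/2) * (divg u_s x + divg u_n x)"
      unfolding avg_def[abs_def]
        divg_scaleR_const[OF differentiable_add[OF d[OF reg_u(3)] d[OF reg_u(2)]]]
        divg_add[OF d[OF reg_u(3)] d[OF reg_u(2)]] ..
    then show ?thesis using step1_div[OF x] data_div(2)[OF x] by simp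
  qed
  have bar: "Ck_closure 1 \<Omega> \<phi>_bar"
    unfolding \<phi>_bar by (intro Ck_closure_extrap \<Omega> Ck_closure_2D(1)[OF reg_\<phi>(2)] reg_\<phi>(1))
  have div_new: "divg (avg u_new u_ss) x = 0" if x: "x \<in> \<Omega>" for x
  proof -
    note d = Ck_closure_1_differentiable[OF \<Omega> Ck_closure_2D(1) x]
    \<comment> \<open>Not an equation of the decoupled scheme: it is inherited from
      \<open>u_s\<close> through the pressure correction, and is what makes the mean velocity of
      step 3 divergence-free.\<close>
    have "divg u_ss x = 0"
      using divg_pressure_correction[OF \<Omega> bdd Ck_closure_2D(1)[OF reg_u(3)] bar reg_\<mu>(1) reg_p(2) step2_p step2_u x]
        div_s[OF x] by simp
    moreover have "divg (avg u_new u_ss) x = (1/2) * (divg u_new x + divg u_ss x)"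
      unfolding avg_def[abs_def]
        divg_scaleR_const[OF differentiable_add[OF d[OF reg_u(5)] d[OF reg_u(4)]]]
        divg_add[OF d[OF reg_u(5)] d[OF reg_u(4)]] ..
    ultimately show ?thesis using step3_div[OF x] by simp
  qed
  from bar step1_\<phi> data_bc_\<phi>(2) reg_\<phi>(2) have 2: "total_energy \<rho> \<gamma> \<epsilon> \<Omega> u_ss \<phi>_ss - total_energy \<rho> \<gamma> \<epsilon> \<Omega> u_s \<phi>_s
      = - \<delta>t * (L2_norm \<Omega> (\<lambda>x. sqrt (M (\<phi>_bar x)) *\<^sub>R grad \<mu> x))\<^sup>2"
    by (intro total_energy_step[OF dom pos(1,4,5) M_nonneg reg_u(3,4) _ _ reg_\<phi>(3) reg_\<mu> reg_p(2) div_s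
          step1_bc step2_bc_u _ step2_bc(2,1,3) step2_\<phi> step2_\<mu> step2_p step2_u]) auto
  have 1: "kinetic_energy \<rho> \<Omega> u_s - kinetic_energy \<rho> \<Omega> u_n
      = - (\<delta>t / 2) * (\<eta> * (L2_norm \<Omega> (grad_abs (avg u_s u_n)))\<^sup>2)"
    by (rule kinetic_energy_step[OF dom pos(5) reg_u(2,3) Ck_closure_extrap[OF \<Omega> u1] reg_p(1)
          data_bc_u(2) step1_bc step1_mom step1_div])
  have 3: "kinetic_energy \<rho> \<Omega> u_new - kinetic_energy \<rho> \<Omega> u_ss
      = - (\<delta>t / 2) * (\<eta> * (L2_norm \<Omega> (grad_abs (avg u_new u_ss)))\<^sup>2)"
    by (rule kinetic_energy_step[OF dom pos(5) reg_u(4,5) Ck_closure_extrap[OF \<Omega> u1] reg_p(3)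
          step2_bc_u step3_bc step3_mom[unfolded avg_comm[of u_ss u_new]] div_new])
  \<comment> \<open>The phase field is unchanged in the outer steps, so their kinetic changes are
    changes of the total energy and the three balances telescope. The factor 2 before the last norm
    reflects that the middle step has length \<open>\<delta>t\<close> and the outer ones half of
    it.\<close>
  show ?thesis
    using 1 2 3 unfolding total_energy_def step1_\<phi> step3_\<phi> by (simp add: algebra_simps)
qed

end
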